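(* Let $\vec H$ be a fixed oriented graph (with at least three vertices) whose underlying undirected graph $H$ is bipartite, and suppose $\vec H$ is not well-oriented. \begin{itemize} \item If some connected component of $H$ contains at least two non-well-oriented vertices of $\vec H$, or some connected component of $H$ contains a non-well-oriented vertex of $\vec H$ and a cycle, then $R^1_{2/3}(\textsc{Sub}(\vec H))=\Omega(n^2)$. \item Else, if $H$ is a forest, then $R^1_{2/3}(\textsc{Sub}(\vec H))=\tilde O(n)$. \item Otherwise, every connected component of $\vec H$ is either a well-oriented bipartite graph or a tree with exactly one non-well-oriented vertex, and $R^1_{2/3}(\textsc{Sub}(\vec H))=\tilde O(n^{2-1/\Delta'(H)})$. \end{itemize}
   Context: An oriented graph is a digraph in which each pair of vertices is joined by at most one arc; $H$ denotes the underlying undirected graph of $\vec H$. An oriented bipartite graph is well-oriented if there is a bipartition $A\sqcup B$ of its vertices such that every arc goes from $A$ to $B$. A vertex of $\vec H$ is non-well-oriented if both its in-degree and out-degree in $\vec H$ are non-zero. For bipartite $H$ with bipartition $A(H)\sqcup B(H)$, $\Delta'(H)=\min\{\max_{v\in A(H)}\deg_H(v),\max_{v\in B(H)}\deg_H(v)\}$. Insertion-only streaming model: the arcs of an $n$-vertex oriented input graph $\vec G$ arrive as a stream in arbitrary order; the algorithm knows $n$, makes $p$ passes, and has $S$ bits of memory. $\textsc{Sub}(\vec H)$: decide whether $\vec G$ contains $\vec H$ as a subgraph (respecting orientations), and if so output the vertex set of a copy. $R^p_{2/3}(\Pi)$ is the minimum space of a randomized $p$-pass streaming algorithm solving $\Pi$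 with success probability at least $2/3$. $\tilde O$ hides polylogarithmic factors in $n$; asymptotics as $n\to\infty$ with $\vec H$ fixed. *)

theory Defs
  imports "HOL-Probability.Probability_Mass_Function"
begin

definition oriented :: "'a set \<Rightarrow> ('a \<times> 'a) set \<Rightarrow> bool" where
  "oriented V A \<longleftrightarrow> finite V \<and> A \<subseteq> V \<times> V \<and> (\<forall>v. (v, v) \<notin> A)
     \<and> (\<forall>u v. (u, v) \<in> A \<longrightarrow> (v, u) \<notin> A)"

definition uadj :: "('a \<times> 'a) set \<Rightarrow> 'a \<Rightarrow> 'a \<Rightarrow> bool" where
  "uadj A u v \<longleftrightarrow> (u, v) \<in> A \<or> (v, u) \<in> A"

definition udeg :: "('a \<times> 'a) set \<Rightarrow> 'a \<Rightarrow> nat" where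
  "udeg A v = card {u. uadj A u v}"

definition bipartition :: "'a set \<Rightarrow> ('a \<times> 'a) set \<Rightarrow> 'a set \<Rightarrow> bool" where
  "bipartition V A X \<longleftrightarrow> X \<subseteq> V \<and> (\<forall>(u, v) \<in> A. (u \<in> X \<longleftrightarrow> v \<notin> X))"

definition bipartite :: "'a set \<Rightarrow> ('a \<times> 'a) set \<Rightarrow> bool" where
  "bipartite V A \<longleftrightarrow> (\<exists>X. bipartition V A X)"

definition well_oriented :: "'a set \<Rightarrow> ('a \<times> 'a) set \<Rightarrow> bool" where
  "well_oriented V A \<longleftrightarrow> (\<exists>X. X \<subseteq> V \<and> (\<forall>(u, v) \<in> A. u \<in> X \<and> v \<in> V - X))"

definition non_wo :: "('a \<times> 'a) set \<Rightarrow> 'a \<Rightarrow> bool" where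
  "non_wo A v \<longleftrightarrow> (\<exists>u. (u, v) \<in> A) \<and> (\<exists>w. (v, w) \<in> A)"

definition component :: "'a set \<Rightarrow> ('a \<times> 'a) set \<Rightarrow> 'a \<Rightarrow> 'a set" where
  "component V A v = {u \<in> V. (uadj A)\<^sup>*\<^sup>* v u}"

definition components :: "'a set \<Rightarrow> ('a \<times> 'a) set \<Rightarrow> 'a set set" where
  "components V A = component V A ` V"

definition has_cycle_in :: "('a \<times> 'a) set \<Rightarrow> 'a set \<Rightarrow> bool" where
  "has_cycle_in A C \<longleftrightarrow> (\<exists>xs. length xs \<ge> 3 \<and> distinct xs \<and> set xs \<subseteq> C \<and>
      (\<forall>i < length xs. uadj A (xs ! i) (xs ! ((i + 1) mod length xs))))"

definition forest :: "'a set \<Rightarrow> ('a \<times> 'a) set \<Rightarrow> bool" where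
  "forest V A \<longleftrightarrow> \<not> has_cycle_in A V"

definition Delta' :: "'a set \<Rightarrow> ('a \<times> 'a) set \<Rightarrow> 'a set \<Rightarrow> nat" where
  "Delta' V A X = min (Max (insert 0 (udeg A ` X))) (Max (insert 0 (udeg A ` (V - X))))"

definition is_copy :: "nat \<Rightarrow> 'a set \<Rightarrow> ('a \<times> 'a) set \<Rightarrow> (nat \<times> nat) set \<Rightarrow> ('a \<Rightarrow> nat) \<Rightarrow> bool" where
  "is_copy n V A E f \<longleftrightarrow> inj_on f V \<and> f ` V \<subseteq> {..<n} \<and> (\<forall>(u, v) \<in> A. (f u, f v) \<in> E)"

definition sub_correct :: "nat \<Rightarrow> 'a set \<Rightarrow> ('a \<times> 'a) set \<Rightarrow> (nat \<times> nat) set \<Rightarrow> nat set option \<Rightarrow> bool" where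
  "sub_correct n V A E out \<longleftrightarrow>
     (case out of None \<Rightarrow> \<not> (\<exists>f. is_copy n V A E f)
                | Some W \<Rightarrow> (\<exists>f. is_copy n V A E f \<and> W = f ` V))"

text \<open>A one-pass randomized streaming algorithm (for a fixed n) is given by a random initial
  memory state, a randomized transition on reading an arc, and a randomized output function.
  Memory states are numbers below 2^S (i.e. S-bit strings).\<close>
definition space_bounded :: "nat \<Rightarrow> nat pmf \<Rightarrow> (nat \<Rightarrow> nat \<times> nat \<Rightarrow> nat pmf) \<Rightarrow> bool" where
  "space_bounded S init step \<longleftrightarrow> set_pmf init \<subseteq> {..<2 ^ S} \<and>
     (\<forall>s < 2 ^ S. \<forall>a. set_pmf (step s a) \<subseteq> {..<2 ^ S})"

definition run1 :: "nat pmf \<Rightarrow> (nat \<Rightarrow> nat \<times> nat \<Rightarrow> nat pmf) \<Rightarrow> (nat \<Rightarrow> 'o pmf) \<Rightarrow> (nat \<times> nat) list \<Rightarrow> 'o pmf" where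
  "run1 init step out xs = bind_pmf (foldl (\<lambda>p a. bind_pmf p (\<lambda>s. step s a)) init xs) out"

definition sub_solvable1 :: "'a set \<Rightarrow> ('a \<times> 'a) set \<Rightarrow> nat \<Rightarrow> nat \<Rightarrow> bool" where
  "sub_solvable1 V A n S \<longleftrightarrow>
     (\<exists>init step (out :: nat \<Rightarrow> nat set option pmf). space_bounded S init step \<and>
        (\<forall>E xs. oriented {..<n} E \<and> distinct xs \<and> set xs = E \<longrightarrow>
           measure_pmf.prob (run1 init step out xs) {r. sub_correct n V A E r} \<ge> 2 / 3))"

definition R1_Omega_n2 :: "'a set \<Rightarrow> ('a \<times> 'a) set \<Rightarrow> bool" where
  "R1_Omega_n2 V A \<longleftrightarrow> (\<exists>c > 0. \<exists>N. \<forall>n \<ge> N. \<forall>S. sub_solvable1 V A n S \<longrightarrow>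
      real S \<ge> c * real n ^ 2)"

definition R1_tildeO :: "'a set \<Rightarrow> ('a \<times> 'a) set \<Rightarrow> real \<Rightarrow> bool" where
  "R1_tildeO V A e \<longleftrightarrow> (\<exists>C k N. \<forall>n \<ge> N. \<exists>S. sub_solvable1 V A n S \<and>
      real S \<le> C * real n powr e * (ln (real n)) ^ k)"

end

theory Submission
  imports Defs
begin

text \<open>Lower bound. Call a walk odd if both its ends are non-well-oriented vertices and some edge is
  traversed an odd number of times; the first hypothesis of the theorem is exactly what is needed for
  an odd walk to exist. Take a shortest one, of length \<open>L\<close>, and let \<open>(a, b)\<close> be its middle arc. In the
  index problem, Alice's bits are arcs \<open>P \<rightarrow> Q\<close> and Bob attaches the pattern minus \<open>(a, b)\<close> at the
  vertices \<open>p\<close> and \<open>q\<close> of the queried bit. Collapsing \<open>P\<close> to \<open>a\<close> and \<open>Q\<close> to \<open>b\<close> is a homomorphism to the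
  pattern. If the bit is \<open>0\<close>, it maps the odd walks of length \<open>L\<close> injectively to those avoiding
  \<open>(a, b)\<close>, because both ends of the middle arc are too far from the non-well-oriented vertices for a
  longer detour. So there are strictly fewer such walks than in the pattern, hence no copy of it.

  Upper bounds, by deterministic algorithms. For trees with one non-well-oriented vertex, store an
  arc \<open>(u, v)\<close> unless \<open>u\<close> and \<open>v\<close> already are a tail and a head of a set of stored arcs with all
  degrees at least \<open>K\<close>. The stored set is \<open>K\<close>-degenerate, so it has \<open>O(n)\<close> arcs. A discarded arc of a
  tree copy can be rerouted: root the tree at its non-well-oriented vertex and re-embed everything
  below the arc greedily into the dense part. For the well-oriented components, store in addition
  the first \<open>O(n\<^bsup>2 - 1/\<Delta>'\<^esup>)\<close> arcs; if there are that many, dependent random choice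
  finds these components among them, disjoint from the trees.\<close>

subsection \<open>The index problem\<close>

text \<open>Here \<open>p x\<close> is the memory after Alice has processed \<open>x\<close>, and
  \<open>\<beta> i s\<close> is Bob's probability of answering yes on index \<open>i\<close> from
  memory \<open>s\<close>. A product potential has expectation at least 1 under every
  \<open>p x\<close>, while its sum over all \<open>x\<close> factorises over the coordinates, with
  factors at most \<open>3 * 2 powr (-2/3)\<close>, about 1.89 and hence below 2.\<close>

lemma random_access_code_bound:
  fixes p :: "'i set \<Rightarrow> nat pmf" and \<beta> :: "'i \<Rightarrow> nat \<Rightarrow> real"
  assumes fin: "finite I"
    and supp: "\<And>x. x \<subseteq> I \<Longrightarrow> set_pmf (p x) \<subseteq> {..<m}"
    and b0: "\<And>i s. 0 \<le> \<beta> i s" and b1: "\<And>i s. \<beta> i s \<le> 1"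
    and yes: "\<And>x i. x \<subseteq> I \<Longrightarrow> i \<in> x \<Longrightarrow> measure_pmf.expectation (p x) (\<beta> i) \<ge> 2/3"
    and no: "\<And>x i. x \<subseteq> I \<Longrightarrow> i \<in> I - x \<Longrightarrow> measure_pmf.expectation (p x) (\<beta> i) \<le> 1/3"
  shows "(2::real) ^ card I \<le> real m * (3 * 2 powr (-2/3)) ^ card I"
proof -
  \<comment> \<open>\<open>q x i s\<close> is Bob's probability of being right at \<open>i\<close>;
    the potential \<open>h\<close> compares it with 2/3 at all coordinates at once.\<close>
  define q where "q x i s = (if i \<in> x then \<beta> i s else 1 - \<beta> i s)" for x i s
  define h where "h s x = (\<Prod>i\<in>I. 2 powr (q x i s - 2/3))" for s x
  have h0: "h s x \<ge> 0" for s x unfolding h_def by (intro prod_nonneg) auto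
  have E: "measure_pmf.expectation (p x) f = (\<Sum>s<m. f s * pmf (p x) s)" if "x \<subseteq> I" for x and f :: "nat \<Rightarrow> real"
    using supp[OF that] by (intro integral_measure_pmf_real) auto
  have tot: "(\<Sum>s<m. pmf (p x) s) = 1" if "x \<subseteq> I" for x
    using E[OF that, of "\<lambda>_. 1"] by simp
  \<comment> \<open>Written as an exponential, \<open>h s x\<close> is at least 1 plus a multiple of
    the total excess over 2/3, whose mean is nonnegative. Dropping the weights
    \<open>pmf (p x) s\<close> at the end leaves a sum that no longer mentions \<open>p x\<close>,
    so it can be summed over \<open>x\<close>.\<close>
  have 1: "1 \<le> (\<Sum>s<m. h s x)" if x: "x \<subseteq> I" for x
  proof -
    have eq: "(\<Sum>s<m. (q x i s - 2/3) * pmf (p x) s) \<ge> 0" if i: "i \<in> I" for i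
    proof (cases "i \<in> x")
      case True
      with yes[OF x True] show ?thesis unfolding E[OF x] q_def
        by (simp add: left_diff_distrib sum_subtractf tot[OF x] flip: sum_divide_distrib sum_distrib_left)
    next
      case False
      have "(\<Sum>s<m. (q x i s - 2/3) * pmf (p x) s) = 1/3 - (\<Sum>s<m. \<beta> i s * pmf (p x) s)"
        using False by (simp add: q_def left_diff_distrib sum_subtractf tot[OF x] flip: sum_divide_distrib sum_distrib_left)
      with no[OF x, of i] False i show ?thesis unfolding E[OF x] by simp
    qed
    have "1 \<le> 1 + ln 2 * (\<Sum>i\<in>I. \<Sum>s<m. (q x i s - 2/3) * pmf (p x) s)"
      using eq by (simp add: sum_nonneg)
    also have "\<dots> = (\<Sum>s<m. (1 + ln 2 * (\<Sum>i\<in>I. q x i s - 2/3)) * pmf (p x) s)"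
      by (subst sum.swap) (simp add: distrib_right sum.distrib tot[OF x] sum_distrib_left sum_distrib_right mult.assoc)
    also have "\<dots> \<le> (\<Sum>s<m. h s x * pmf (p x) s)"
    proof (intro sum_mono mult_right_mono)
      fix s
      have "h s x = exp (\<Sum>i\<in>I. ln 2 * (q x i s - 2/3))"
        using fin by (simp add: h_def exp_sum powr_def mult.commute)
      then show "1 + ln 2 * (\<Sum>i\<in>I. q x i s - 2/3) \<le> h s x"
        using exp_ge_add_one_self by (simp add: sum_distrib_left)
    qed auto
    also have "\<dots> \<le> (\<Sum>s<m. h s x)"
      by (intro sum_mono) (simp add: h0 mult_left_le pmf_le_1)
    finally show ?thesis .
  qed
  \<comment> \<open>The chord bound for a convex function on [0, 1]; applied to
    \<open>\<beta> i s\<close> and \<open>1 - \<beta> i s\<close> the two chords add up to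
    3.\<close>
  have powr2: "2 powr t \<le> 1 + t" if "0 \<le> t" "t \<le> 1" for t :: real
  proof -
    have "2 powr t = exp ((1 - t) *\<^sub>R 0 + t *\<^sub>R ln 2)"
      by (simp add: powr_def del: ln_powr)
    also have "\<dots> \<le> (1 - t) * exp 0 + t * exp (ln (2::real))"
      by (rule convex_onD[OF exp_convex]) (use that in auto)
    also have "\<dots> = 1 + t" by simp
    finally show ?thesis .
  qed
  have 2: "(\<Sum>x\<in>Pow I. h s x) \<le> (3 * 2 powr (-2/3)) ^ card I" for s
  proof -
    have "(\<Sum>x\<in>Pow I. h s x) = (\<Sum>x\<in>Pow I. (\<Prod>i\<in>x. 2 powr (\<beta> i s - 2/3)) * (\<Prod>i\<in>I-x. 2 powr (1 - \<beta> i s - 2/3)))"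
    proof (rule sum.cong[OF refl])
      fix x assume "x \<in> Pow I"
      then have "h s x = (\<Prod>i\<in>I-x. 2 powr (q x i s - 2/3)) * (\<Prod>i\<in>x. 2 powr (q x i s - 2/3))"
        unfolding h_def using fin by (intro prod.subset_diff) auto
      then show "h s x = (\<Prod>i\<in>x. 2 powr (\<beta> i s - 2/3)) * (\<Prod>i\<in>I-x. 2 powr (1 - \<beta> i s - 2/3))"
        by (simp add: q_def)
    qed
    also have "\<dots> = (\<Prod>i\<in>I. 2 powr (\<beta> i s - 2/3) + 2 powr (1 - \<beta> i s - 2/3))"
      by (rule prod_add[OF fin, symmetric])
    also have "\<dots> \<le> (\<Prod>i\<in>I. 3 * 2 powr (-2/3))"
    proof (intro prod_mono conjI)
      fix i
      have split: "2 powr (t - 2/3) = 2 powr t * 2 powr (-2/3)" for t :: real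
        by (subst powr_add[symmetric]) (rule arg_cong, simp)
      have "2 powr (\<beta> i s) + 2 powr (1 - \<beta> i s) \<le> 3"
        using powr2[OF b0 b1, of i s] powr2[of "1 - \<beta> i s"] b0[of i s] b1[of i s] by linarith
      then have "(2 powr (\<beta> i s) + 2 powr (1 - \<beta> i s)) * 2 powr (-2/3) \<le> 3 * 2 powr (-2/3)"
        by (intro mult_right_mono) auto
      then show "2 powr (\<beta> i s - 2/3) + 2 powr (1 - \<beta> i s - 2/3) \<le> 3 * 2 powr (-2/3)"
        unfolding split distrib_right .
    qed auto
    finally show ?thesis by simp
  qed
  have "(2::real) ^ card I = (\<Sum>x\<in>Pow I. 1)" using fin by (simp add: card_Pow)
  also have "\<dots> \<le> (\<Sum>x\<in>Pow I. \<Sum>s<m. h s x)" using 1 by (intro sum_mono) auto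
  also have "\<dots> = (\<Sum>s<m. \<Sum>x\<in>Pow I. h s x)" by (rule sum.swap)
  also have "\<dots> \<le> (\<Sum>s<m. (3 * 2 powr (-2/3)) ^ card I)" using 2 by (intro sum_mono)
  finally show ?thesis by simp
qed

text \<open>Binary logarithms of the previous bound; the constant is positive because 27 <
  32.\<close>

lemma random_access_code_space:
  assumes "(2::real) ^ N \<le> real (2 ^ S) * (3 * 2 powr (-2/3)) ^ N"
  shows "real S \<ge> (5/3 - log 2 3) * real N" and "5/3 - log 2 3 > (0::real)"
proof -
  have "log 2 (2 ^ N) \<le> log 2 (real (2 ^ S) * (3 * 2 powr (-2/3)) ^ N)"
    using assms by (subst log_le_cancel_iff) auto
  also have "\<dots> = real S + real N * (log 2 3 - 2/3)"
  proof -
    have "log 2 (real (2 ^ S) * (3 * 2 powr (-2/3)) ^ N) = log 2 (2 ^ S) + log 2 ((3 * 2 powr (-2/3)) ^ N)"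
      by (subst log_mult) auto
    also have "log 2 ((3 * 2 powr (-2/3)) ^ N) = real N * log 2 (3 * 2 powr (-2/3))"
      by (rule log_nat_power) auto
    also have "log 2 (3 * 2 powr (-2/3)) = log 2 3 - 2/3"
      by (subst log_mult) auto
    finally show ?thesis by (simp add: log_nat_power)
  qed
  finally have le: "real N \<le> real S + real N * (log 2 3 - 2/3)" by simp
  have "(5/3 - c) * x \<le> y" if "x \<le> y + x * (c - 2/3)" for c x y :: real
    using that by (simp add: field_simps)
  from this[OF le] show "real S \<ge> (5/3 - log 2 3) * real N" .
  have "log 2 (3 ^ 3) < log 2 (2 ^ 5 :: real)" by (subst log_less_cancel_iff) auto
  then show "5/3 - log 2 3 > (0::real)" by (simp only: log_nat_power) (simp add: log_nat_power)
qed

subsection \<open>Odd walks\<close>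

fun edge_count :: "'a set \<Rightarrow> 'a list \<Rightarrow> nat" where
  "edge_count e (x # y # zs) = (if {x, y} = e then 1 else 0) + edge_count e (y # zs)"
| "edge_count e _ = 0"

lemma edge_count_append: "edge_count e (xs @ z # ys) = edge_count e (xs @ [z]) + edge_count e (z # ys)"
  by (induction e xs rule: edge_count.induct) (cases ys, auto)

lemma edge_count_rev [simp]: "edge_count e (rev xs) = edge_count e xs"
proof (induction e xs rule: edge_count.induct)
  case (1 e x y zs)
  have "edge_count e (rev (x # y # zs)) = edge_count e (rev zs @ y # [x])" by simp
  also have "\<dots> = edge_count e (rev (y # zs)) + edge_count e [y, x]"
    by (subst edge_count_append) simp
  finally show ?case using 1 by (simp add: insert_commute)
qed auto

lemma edge_count_pos: "edge_count e xs \<noteq> 0 \<Longrightarrow> e \<subseteq> set xs"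
  by (induction e xs rule: edge_count.induct) (auto split: if_splits)

text \<open>Injectivity must cover \<open>e\<close> too: otherwise an edge off the walk could share
  its image with one on it.\<close>

lemma edge_count_map:
  "inj_on f (e \<union> set xs) \<Longrightarrow> edge_count (f ` e) (map f xs) = edge_count e xs"
proof (induction e xs rule: edge_count.induct)
  case (1 e x y zs)
  have "{f x, f y} = f ` e \<longleftrightarrow> {x, y} = e"
    using inj_on_image_eq_iff[OF "1.prems", of "{x, y}" e] by auto
  moreover have "inj_on f (e \<union> set (y # zs))"
    using "1.prems" by (rule inj_on_subset) auto
  ultimately show ?case using 1 by simp
qed auto

text \<open>Multiplicities modulo 2 add up under splicing, and a detour followed by its reverse
  changes none of them. Closed walks in a tree use every edge an even number of times and are
  thereby excluded.\<close>

definition odd_walks :: "('a \<times> 'a) set \<Rightarrow> nat \<Rightarrow> 'a list set" where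
  "odd_walks A L = {xs. length xs = Suc L \<and> successively (uadj A) xs \<and> non_wo A (hd xs) \<and>
      non_wo A (last xs) \<and> (\<exists>e. odd (edge_count e xs))}"

lemma uadj_sym: "uadj A u v \<Longrightarrow> uadj A v u"
  by (auto simp: uadj_def)

lemma successively_uadj_rev [simp]: "successively (uadj A) (rev xs) = successively (uadj A) xs"
  by (simp add: uadj_def disj_commute)

lemma walk_subset_Field:
  assumes "successively (uadj A) xs" "xs \<noteq> []" "hd xs \<in> Field A"
  shows "set xs \<subseteq> Field A"
  using assms
proof (induction xs)
  case (Cons x xs)
  then show ?case
    by (cases xs) (auto simp: uadj_def Field_def)
qed auto

lemma finite_odd_walks:
  assumes "finite A"
  shows "finite (odd_walks A L)"
proof (rule finite_subset)
  show "odd_walks A L \<subseteq> {xs. set xs \<subseteq> Field A \<and> length xs = Suc L}"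
  proof
    fix xs assume xs: "xs \<in> odd_walks A L"
    then have "hd xs \<in> Field A" by (auto simp: odd_walks_def non_wo_def Field_def)
    then have "set xs \<subseteq> Field A"
      using xs by (intro walk_subset_Field) (auto simp: odd_walks_def)
    then show "xs \<in> {xs. set xs \<subseteq> Field A \<and> length xs = Suc L}"
      using xs by (auto simp: odd_walks_def)
  qed
  show "finite {xs. set xs \<subseteq> Field A \<and> length xs = Suc L}"
    using assms by (intro finite_lists_length_eq) (simp add: finite_Field)
qed

definition minimal_odd_walk :: "('a \<times> 'a) set \<Rightarrow> nat \<Rightarrow> 'a list \<Rightarrow> bool" where
  "minimal_odd_walk A L x \<longleftrightarrow> x \<in> odd_walks A L \<and> (\<forall>L' < L. odd_walks A L' = {})"

text \<open>A short walk from a non-well-oriented vertex to \<open>x ! j\<close> splits \<open>x\<close> into two shorter walks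
  whose edge multiplicities add up, modulo 2, to those of \<open>x\<close>.\<close>
lemma minimal_odd_walk_dist:
  assumes x: "minimal_odd_walk A L x"
    and j: "j \<le> L"
    and y: "successively (uadj A) y" "y \<noteq> []" "non_wo A (hd y)" "last y = x ! j"
  shows "length y > min j (L - j)"
proof (rule ccontr)
  assume short: "\<not> ?thesis"
  have xo: "length x = Suc L" "successively (uadj A) x" "non_wo A (hd x)" "non_wo A (last x)"
    "\<exists>e. odd (edge_count e x)"
    and min: "\<And>L'. L' < L \<Longrightarrow> odd_walks A L' = {}"
    using x by (auto simp: minimal_odd_walk_def odd_walks_def)
  obtain e where e: "odd (edge_count e x)" using xo by blast
  define u where "u = take j x"
  define v where "v = drop (Suc j) x"
  define z where "z = x ! j"
  have x_eq: "x = u @ z # v" using j xo(1) by (simp add: u_def v_def z_def id_take_nth_drop)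
  have len: "length u = j" "length v = L - j" using j xo(1) by (auto simp: u_def v_def)
  obtain y' where y': "y = y' @ [z]"
    using y(2,4) by (metis append_butlast_last_id z_def)
  \<comment> \<open>The length of \<open>y'\<close> is the number of edges of \<open>y\<close>.
    Being below both \<open>j\<close> and \<open>L - j\<close>, it makes \<open>w1\<close> (along
    \<open>x\<close>, then back along \<open>y\<close>) and \<open>w2\<close> (along
    \<open>y\<close>, then on along \<open>x\<close>) shorter than \<open>x\<close>.\<close>
  have lens: "length y' < j" "length y' < L - j" using short y' by auto
  define w1 where "w1 = u @ z # rev y'"
  define w2 where "w2 = y' @ z # v"
  have s1: "successively (uadj A) (u @ [z])" "successively (uadj A) (z # v)"
    using xo(2) unfolding x_eq by (auto simp: successively_append_iff successively_Cons)
  have "successively (uadj A) (rev y)" using y(1) by (simp only: successively_uadj_rev)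
  then have s2: "successively (uadj A) (z # rev y')" by (simp add: y' del: successively_rev)
  have w: "successively (uadj A) w1" "successively (uadj A) w2"
    using s1 s2 y(1) unfolding w1_def w2_def y'
    by (auto simp: successively_append_iff successively_Cons simp del: successively_rev)
  have ends: "hd w1 = hd x" "last w1 = hd y" "hd w2 = hd y" "last w2 = last x"
    unfolding w1_def w2_def y' x_eq using lens by (auto simp: hd_append last_append last_rev hd_rev)
  have "edge_count e w1 = edge_count e (u @ [z]) + edge_count e (rev y)"
    unfolding w1_def y' by (subst edge_count_append) simp
  moreover have "edge_count e w2 = edge_count e y + edge_count e (z # v)"
    unfolding w2_def y' by (subst edge_count_append) simp
  moreover have "edge_count e x = edge_count e (u @ [z]) + edge_count e (z # v)"
    unfolding x_eq by (rule edge_count_append)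
  ultimately have "odd (edge_count e w1) \<or> odd (edge_count e w2)" using e by auto
  then have "w1 \<in> odd_walks A (length w1 - 1) \<or> w2 \<in> odd_walks A (length w2 - 1)"
    using w ends xo y by (auto simp: odd_walks_def w1_def w2_def)
  moreover have "length w1 - 1 < L" "length w2 - 1 < L"
    using lens len j by (auto simp: w1_def w2_def)
  ultimately show False using min by blast
qed

text \<open>\<open>B\<close> encodes the bit string of the index problem as arcs from \<open>P\<close> to \<open>Q\<close>; \<open>g\<close> embeds the pattern
  so that its arc \<open>(a, b)\<close>, the middle step of a shortest odd walk \<open>x\<close>, falls on the queried bit,
  which is \<open>0\<close> here.\<close>
locale gadget =
  fixes A :: "('a \<times> 'a) set" and V :: "'a set" and x :: "'a list" and L :: nat and a b :: 'a
    and P Q :: "nat set" and B :: "(nat \<times> nat) set" and g :: "'a \<Rightarrow> nat"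
  assumes orient: "oriented V A"
    and fin: "finite B"
    and x: "minimal_odd_walk A L x"
    and ab: "(a, b) \<in> A" "{a, b} = {x ! ((L - 1) div 2), x ! Suc ((L - 1) div 2)}" "L \<ge> 1"
    and PQ: "P \<inter> Q = {}"
    and g: "inj_on g V" "g a \<in> P" "g b \<in> Q" "g ` (V - {a, b}) \<inter> (P \<union> Q) = {}"
    and B: "B \<subseteq> P \<times> Q - {(g a, g b)}"
begin

definition "E = B \<union> map_prod g g ` (A - {(a, b)})"

definition "proj z = (if z \<in> P then a else if z \<in> Q then b else inv_into V g z)"

lemma in_V: "(u, v) \<in> A \<Longrightarrow> u \<in> V \<and> v \<in> V"
  using orient by (auto simp: oriented_def)

lemma abV: "a \<in> V" "b \<in> V" "a \<noteq> b" "(b, a) \<notin> A"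
  using ab in_V orient by (auto simp: oriented_def)

lemma proj_g [simp]:
  assumes "v \<in> V" shows "proj (g v) = v"
proof -
  consider "v = a" | "v = b" | "v \<in> V - {a, b}" using assms by blast
  then show ?thesis
  proof cases
    case 3
    then have "g v \<notin> P \<union> Q" using g(4) by blast
    then show ?thesis using g(1) assms by (simp add: proj_def)
  qed (use g PQ in \<open>auto simp: proj_def\<close>)
qed

text \<open>Arcs of \<open>B\<close> collapse to \<open>(a, b)\<close>; attached arcs return to the
  pattern arcs they came from.\<close>

lemma proj_arc: "(u, v) \<in> E \<Longrightarrow> (proj u, proj v) \<in> A"
  using B PQ ab in_V by (auto simp: E_def) (auto simp: proj_def)

lemma proj_uadj: "uadj E u v \<Longrightarrow> uadj A (proj u) (proj v)"
  using proj_arc by (auto simp: uadj_def)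

text \<open>The image of \<open>g\<close> meets \<open>P\<close> and \<open>Q\<close> only in
  \<open>g a\<close> and \<open>g b\<close>, and this one pair is missing from \<open>B\<close>. So
  arcs between vertices of the image are exactly the attached ones.\<close>

lemma proj_uadj_main:
  assumes "u \<in> V" "v \<in> V" "uadj E (g u) (g v)"
  shows "uadj (A - {(a, b)}) u v"
proof -
  have main: "(u, v) \<in> A - {(a, b)}" if uv: "u \<in> V" "v \<in> V" "(g u, g v) \<in> E" for u v
  proof (cases "(g u, g v) \<in> B")
    case True
    then have "g u \<in> P" "g v \<in> Q" using B by auto
    then have "u = a" "v = b" using uv g PQ by blast+
    then show ?thesis using True B by auto
  next
    case False
    then have "(g u, g v) \<in> map_prod g g ` (A - {(a, b)})" using uv by (auto simp: E_def)
    then obtain u' v' where "(u', v') \<in> A - {(a, b)}" "g u = g u'" "g v = g v'" by auto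
    then show ?thesis using uv in_V inj_onD[OF g(1)] by (metis DiffD1)
  qed
  show ?thesis using assms main by (auto simp: uadj_def)
qed

lemma proj_non_wo: "non_wo E z \<Longrightarrow> non_wo A (proj z)"
  unfolding non_wo_def using proj_arc by blast

text \<open>Outside the image of \<open>g\<close> all arcs belong to \<open>B\<close>, where a
  vertex of \<open>P\<close> only emits and a vertex of \<open>Q\<close> only receives.\<close>

lemma non_wo_main: "non_wo E z \<Longrightarrow> z \<in> g ` V"
  using B PQ in_V by (fastforce simp: E_def non_wo_def)

text \<open>All neighbours of such a vertex lie on one side of the index graph, so a walk passing
  through it projects to a backtrack along the edge between \<open>a\<close> and
  \<open>b\<close>.\<close>

lemma non_main:
  assumes "z \<notin> g ` V" "uadj E z w"
  shows "proj w \<in> {a, b}" "proj w = (if z \<in> P then b else a)"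
proof -
  have "(z, w) \<in> B \<or> (w, z) \<in> B" using assms in_V by (auto simp: E_def uadj_def)
  then show "proj w \<in> {a, b}" "proj w = (if z \<in> P then b else a)" using B PQ by (auto simp: proj_def)
qed

lemma proj_walk: "successively (uadj E) w \<Longrightarrow> successively (uadj A) (map proj w)"
  unfolding successively_map by (erule successively_mono) (auto intro: proj_uadj)

lemma proj_inj: "inj_on proj (g ` V)"
  by (rule inj_onI) auto

text \<open>Project the walk to \<open>A\<close> and apply \<open>minimal_odd_walk_dist\<close> at
  the middle step of \<open>x\<close>: its ends have index \<open>m\<close> and \<open>m + 1\<close>
  for \<open>m = (L - 1) div 2\<close>, and both are at least \<open>m\<close> away from either end
  of \<open>x\<close>.\<close>

lemma dist_ab:
  assumes "successively (uadj E) (w @ [z])" "non_wo E (hd (w @ [z]))" "proj z \<in> {a, b}"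
  shows "length w \<ge> (L - 1) div 2"
proof -
  obtain j where j: "j = (L - 1) div 2 \<or> j = Suc ((L - 1) div 2)" "proj z = x ! j"
    using assms(3) ab(2) by (metis insertE singletonD)
  have "non_wo A (proj (hd (w @ [z])))" using assms(2) by (rule proj_non_wo)
  then have "non_wo A (hd (map proj (w @ [z])))" by (subst hd_map) auto
  then have "length (map proj (w @ [z])) > min j (L - j)"
    using j ab(3) proj_walk[OF assms(1)]
    by (intro minimal_odd_walk_dist[OF x]) auto
  then show ?thesis using j(1) ab(3) by auto
qed

text \<open>A walk of length \<open>L\<close> is too short to leave the image of \<open>g\<close> except for a single backtrack at its
  midpoint; cutting the backtrack out would give an odd walk of length \<open>L - 2\<close> in \<open>A\<close>.\<close>
lemma odd_walk_main:
  assumes w: "w \<in> odd_walks E L"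
  shows "set w \<subseteq> g ` V"
proof (rule ccontr)
  assume "\<not> ?thesis"
  then obtain z where z: "z \<in> set w" "z \<notin> g ` V" by blast
  have wo: "length w = Suc L" "successively (uadj E) w" "non_wo E (hd w)" "non_wo E (last w)"
    "\<exists>e. odd (edge_count e w)"
    using w by (auto simp: odd_walks_def)
  define m where "m = (L - 1) div 2"
  \<comment> \<open>Before and after \<open>z\<close> the walk is at vertices projecting to
    \<open>a\<close> or \<open>b\<close>, so each remaining side has at least \<open>m\<close>
    edges. Together with the two edges at \<open>z\<close> this already exhausts
    \<open>L \<le> 2 * m + 2\<close>, which fixes the position of \<open>z\<close>.\<close>
  have pos: "length r = Suc m \<and> L = 2 * m + 2 \<and>
      (\<exists>v p q u. r = v @ [p] \<and> s = q # u \<and> proj p = proj q)"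
    if rs: "w = r @ z # s" "z \<notin> g ` V" for r s z
  proof -
    have "r \<noteq> []" using rs non_wo_main[OF wo(3)] by (cases r) auto
    then obtain v p where r: "r = v @ [p]" by (metis append_butlast_last_id)
    have "s \<noteq> []" using rs non_wo_main[OF wo(4)] by auto
    then obtain q u where s: "s = q # u" by (cases s) auto
    have sp: "successively (uadj E) (v @ [p])" "successively (uadj E) (q # u)" "uadj E p z" "uadj E z q"
      using wo(2) by (auto simp: rs(1) r s successively_append_iff successively_Cons)
    note p = non_main[OF rs(2) uadj_sym[OF sp(3)]]
    note q = non_main[OF rs(2) sp(4)]
    have "length v \<ge> m"
      using wo(3) unfolding m_def by (intro dist_ab[OF sp(1)] p) (auto simp: rs(1) r hd_append)
    moreover have "successively (uadj E) (rev (q # u))"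
      using sp(2) by (simp only: successively_uadj_rev)
    then have "length (rev u) \<ge> m"
      using wo(4) unfolding m_def by (intro dist_ab[of _ q] q) (auto simp: rs(1) s hd_append hd_rev)
    moreover have "L = length v + length u + 2" using wo(1) by (simp add: rs(1) r s)
    moreover have "L \<le> 2 * m + 2" unfolding m_def by linarith
    ultimately show ?thesis using r s p q by auto
  qed
  obtain r s where rs: "w = r @ z # s" using split_list[OF z(1)] by blast
  obtain v p q u where vu: "r = v @ [p]" "s = q # u" "proj p = proj q"
    and L: "length r = Suc m" "L = 2 * m + 2"
    using pos[OF rs z(2)] by blast
  \<comment> \<open>A second vertex outside the image would have to occupy the same position as
    \<open>z\<close>.\<close>
  have main: "y \<in> g ` V" if y: "y \<in> set r \<union> set s" for y
  proof (rule ccontr)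
    assume n: "y \<notin> g ` V"
    from y show False
    proof
      assume "y \<in> set r"
      then obtain r1 r2 where "r = r1 @ y # r2" by (blast dest: split_list)
      then have "w = r1 @ y # (r2 @ z # s)" "length r1 < length r" using rs by auto
      then show False using pos[OF _ n] L(1) by (metis less_irrefl)
    next
      assume "y \<in> set s"
      then obtain s1 s2 where "s = s1 @ y # s2" by (blast dest: split_list)
      then have "w = (r @ z # s1) @ y # s2" "length r < length (r @ z # s1)" using rs by auto
      then show False using pos[OF _ n] L(1) by (metis less_irrefl)
    qed
  qed
  have "p = q" using vu main by (intro inj_onD[OF proj_inj]) auto
  define w' where "w' = v @ p # u"
  have w_eq: "w = v @ p # z # p # u" using rs vu \<open>p = q\<close> by simp
  obtain e where e: "odd (edge_count e w)" using wo by blast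
  have "edge_count e w = edge_count e (v @ [p]) + edge_count e (p # z # p # u)"
    unfolding w_eq by (rule edge_count_append)
  moreover have "edge_count e w' = edge_count e (v @ [p]) + edge_count e (p # u)"
    unfolding w'_def by (rule edge_count_append)
  moreover have "edge_count e (p # z # p # u) = 2 * (if {p, z} = e then 1 else 0) + edge_count e (p # u)"
    by (auto simp: insert_commute)
  ultimately have e': "odd (edge_count e w')" using e by auto
  have sub: "set w' \<subseteq> g ` V" using main vu \<open>p = q\<close> by (auto simp: w'_def)
  \<comment> \<open>The odd edge lies on \<open>w'\<close>, hence in the image of \<open>g\<close>,
    where \<open>proj\<close> is injective; so its parity survives the projection.\<close>
  moreover have "e \<subseteq> set w'" using e' by (intro edge_count_pos) (metis even_zero)
  ultimately have "inj_on proj (e \<union> set w')" using proj_inj by (auto intro: inj_on_subset)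
  then have "odd (edge_count (proj ` e) (map proj w'))" using e' by (simp add: edge_count_map)
  moreover have "successively (uadj E) w'"
    using wo(2) by (auto simp: w_eq w'_def successively_append_iff successively_Cons)
  moreover have "hd w' = hd w" "last w' = last w" by (auto simp: w_eq w'_def hd_append)
  moreover have "length w' = Suc (L - 2)" using wo(1) by (simp add: w_eq w'_def)
  moreover have "w' \<noteq> []" by (simp add: w'_def)
  ultimately have "map proj w' \<in> odd_walks A (L - 2)"
    using wo(3,4) proj_walk[of w'] by (auto simp: odd_walks_def hd_map last_map proj_non_wo)
  moreover have "L - 2 < L" using L by simp
  ultimately show False using x by (auto simp: minimal_odd_walk_def)
qed

lemma finite_A: "finite A"
  using orient finite_subset by (fastforce simp: oriented_def)

lemma card_odd_walks_less: "card (odd_walks E L) < card (odd_walks A L)"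
proof -
  let ?W = "{w \<in> odd_walks A L. successively (uadj (A - {(a, b)})) w}"
  have inj: "inj_on (map proj) (odd_walks E L)"
  proof (rule inj_onI)
    fix w w' assume w: "w \<in> odd_walks E L" "w' \<in> odd_walks E L" "map proj w = map proj w'"
    then show "w = w'"
      using odd_walk_main by (intro map_inj_on[OF w(3)] inj_on_subset[OF proj_inj]) blast
  qed
  have "map proj ` odd_walks E L \<subseteq> ?W"
  proof safe
    fix w assume w: "w \<in> odd_walks E L"
    note main = odd_walk_main[OF w]
    have wo: "length w = Suc L" "successively (uadj E) w" "non_wo E (hd w)" "non_wo E (last w)"
      using w by (auto simp: odd_walks_def)
    obtain e where e: "odd (edge_count e w)" using w by (auto simp: odd_walks_def)
    have "e \<subseteq> set w" using e by (intro edge_count_pos) (metis even_zero)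
    then have "inj_on proj (e \<union> set w)" using proj_inj main by (auto intro: inj_on_subset)
    then have "odd (edge_count (proj ` e) (map proj w))" using e by (simp add: edge_count_map)
    moreover have "w \<noteq> []" using wo(1) by auto
    ultimately show "map proj w \<in> odd_walks A L"
      using wo proj_walk[of w] by (auto simp: odd_walks_def hd_map last_map proj_non_wo)
    show "successively (uadj (A - {(a, b)})) (map proj w)"
      unfolding successively_map using wo(2)
    proof (rule successively_mono)
      fix y z assume yz: "y \<in> set w" "z \<in> set w" "uadj E y z"
      then obtain u v where "y = g u" "z = g v" "u \<in> V" "v \<in> V" using main by blast
      then show "uadj (A - {(a, b)}) (proj y) (proj z)"
        using yz proj_uadj_main by simp
    qed
  qed
  moreover have fin: "finite (odd_walks A L)" by (rule finite_odd_walks[OF finite_A])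
  ultimately have "card (odd_walks E L) \<le> card ?W"
    by (intro card_inj_on_le[OF inj]) (auto intro: finite_subset)
  also have "\<dots> < card (odd_walks A L)"
  proof (rule psubset_card_mono[OF fin])
    let ?m = "(L - 1) div 2"
    have xo: "x \<in> odd_walks A L" "length x = Suc L" using x by (auto simp: minimal_odd_walk_def odd_walks_def)
    \<comment> \<open>Strictness comes from \<open>x\<close> itself, whose middle step traverses the
      removed edge.\<close>
    have "\<not> successively (uadj (A - {(a, b)})) x"
    proof
      assume "successively (uadj (A - {(a, b)})) x"
      moreover have "x = take ?m x @ x ! ?m # x ! Suc ?m # drop (Suc (Suc ?m)) x"
        using xo ab(3) by (simp add: id_take_nth_drop Cons_nth_drop_Suc)
      ultimately have "uadj (A - {(a, b)}) (x ! ?m) (x ! Suc ?m)"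
        by (metis successively.simps(3) successively_append_iff)
      then have "uadj (A - {(a, b)}) a b"
        using ab(2) by (metis doubleton_eq_iff uadj_sym)
      then show False using abV by (auto simp: uadj_def)
    qed
    then show "?W \<subset> odd_walks A L" using xo by blast
  qed
  finally show ?thesis .
qed

text \<open>A copy of the pattern would carry its odd walks of length \<open>L\<close> injectively
  to odd walks of \<open>E\<close>, of which there are too few.\<close>

lemma no_copy: "\<not> is_copy n V A E f"
proof
  assume f: "is_copy n V A E f"
  then have inj: "inj_on f V" and arc: "\<And>u v. (u, v) \<in> A \<Longrightarrow> (f u, f v) \<in> E"
    by (auto simp: is_copy_def)
  have Field: "Field A \<subseteq> V" using in_V by (auto simp: Field_def)
  have sub: "set w \<subseteq> V" if w: "w \<in> odd_walks A L" for w
  proof -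
    have "hd w \<in> Field A" using w by (auto simp: odd_walks_def non_wo_def Field_def)
    then have "set w \<subseteq> Field A"
      using w by (intro walk_subset_Field) (auto simp: odd_walks_def)
    then show ?thesis using Field by blast
  qed
  have "finite E" using fin finite_A by (simp add: E_def)
  have "card (odd_walks A L) \<le> card (odd_walks E L)"
  proof (rule card_inj_on_le)
    show "inj_on (map f) (odd_walks A L)"
      using sub inj by (intro inj_onI) (metis (no_types, lifting) inj_on_subset le_sup_iff map_inj_on)
    show "map f ` odd_walks A L \<subseteq> odd_walks E L"
    proof safe
      fix w assume w: "w \<in> odd_walks A L"
      then have wo: "length w = Suc L" "successively (uadj A) w" "non_wo A (hd w)" "non_wo A (last w)"
        by (auto simp: odd_walks_def)
      obtain e where e: "odd (edge_count e w)" using w by (auto simp: odd_walks_def)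
      have "e \<subseteq> set w" using e by (intro edge_count_pos) (metis even_zero)
      then have "inj_on f (e \<union> set w)" using inj sub[OF w] by (auto intro: inj_on_subset)
      then have "odd (edge_count (f ` e) (map f w))" using e by (simp add: edge_count_map)
      moreover have "successively (uadj E) (map f w)"
        unfolding successively_map using wo(2) by (rule successively_mono) (auto simp: uadj_def arc)
      moreover have "non_wo E (f z)" if "non_wo A z" for z
        using that arc unfolding non_wo_def by blast
      moreover have "w \<noteq> []" using wo(1) by auto
      ultimately show "map f w \<in> odd_walks E L"
        using wo by (auto simp: odd_walks_def hd_map last_map)
    qed
    show "finite (odd_walks E L)" using finite_odd_walks[OF \<open>finite E\<close>] .
  qed
  then show False using card_odd_walks_less by simp
qed

end

section \<open>Existence of odd walks\<close>

lemma cyclic_adjacent_iff: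
  assumes "xs \<noteq> []"
  shows "(\<forall>i < length xs. P (xs ! i) (xs ! ((i + 1) mod length xs))) \<longleftrightarrow> successively P (xs @ [hd xs])"
proof -
  have "(xs @ [hd xs]) ! i = xs ! i" "(xs @ [hd xs]) ! Suc i = xs ! ((i + 1) mod length xs)"
    if "i < length xs" for i
    using that assms by (auto simp: nth_append hd_conv_nth mod_Suc)
  then show ?thesis unfolding successively_conv_nth by auto
qed

lemma has_cycle_in_iff:
  "has_cycle_in A C \<longleftrightarrow> (\<exists>xs. length xs \<ge> 3 \<and> distinct xs \<and> set xs \<subseteq> C \<and> successively (uadj A) (xs @ [hd xs]))"
proof -
  have "(\<forall>i < length xs. uadj A (xs ! i) (xs ! ((i + 1) mod length xs))) \<longleftrightarrow>
      successively (uadj A) (xs @ [hd xs])" if "length xs \<ge> 3" for xs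
    using that by (intro cyclic_adjacent_iff) auto
  then show ?thesis unfolding has_cycle_in_def by metis
qed

lemma rtranclp_distinct_walk:
  assumes "R\<^sup>*\<^sup>* u v"
  obtains xs where "xs \<noteq> []" "hd xs = u" "last xs = v" "successively R xs" "distinct xs"
proof -
  have "\<exists>xs. xs \<noteq> [] \<and> hd xs = u \<and> last xs = v \<and> successively R xs \<and> distinct xs"
    using assms
  proof (induction rule: rtranclp_induct)
    case base
    show ?case by (intro exI[of _ "[u]"]) auto
  next
    case (step y z)
    then obtain xs where xs: "xs \<noteq> []" "hd xs = u" "last xs = y" "successively R xs" "distinct xs"
      by blast
    show ?case
    proof (cases "z \<in> set xs")
      case True
      then obtain ys zs where "xs = ys @ z # zs" by (blast dest: split_list)
      then show ?thesis using xs
        by (intro exI[of _ "ys @ [z]"]) (auto simp: hd_append successively_append_iff)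
    next
      case False
      then show ?thesis using xs step.hyps
        by (intro exI[of _ "xs @ [z]"]) (auto simp: successively_append_iff)
    qed
  qed
  then show ?thesis using that by blast
qed

lemma component_connected:
  assumes "C \<in> components V A" "u \<in> C" "v \<in> C"
  shows "(uadj A)\<^sup>*\<^sup>* u v"
proof -
  obtain c where "(uadj A)\<^sup>*\<^sup>* c u" "(uadj A)\<^sup>*\<^sup>* c v"
    using assms by (auto simp: components_def component_def)
  moreover have "symp (uadj A)" by (auto intro: sympI uadj_sym)
  ultimately show ?thesis by (meson rtranclp_trans sympD symp_rtranclp)
qed

text \<open>A path without repeated vertices traverses its first edge exactly once.\<close>

lemma odd_walk_between_non_wo:
  assumes "(uadj A)\<^sup>*\<^sup>* u v" "u \<noteq> v" "non_wo A u" "non_wo A v"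
  shows "\<exists>L. odd_walks A L \<noteq> {}"
proof -
  obtain xs where xs: "xs \<noteq> []" "hd xs = u" "last xs = v" "successively (uadj A) xs" "distinct xs"
    using rtranclp_distinct_walk[OF assms(1)] .
  then obtain y zs where y: "xs = u # y # zs"
    using assms(2) by (metis last.simps list.exhaust_sel)
  have "edge_count {u, y} (y # zs) = 0"
    using xs(5) edge_count_pos[of "{u, y}" "y # zs"] by (auto simp: y)
  then have "odd (edge_count {u, y} xs)" by (simp add: y)
  then have "xs \<in> odd_walks A (length xs - 1)"
    using xs assms by (auto simp: odd_walks_def)
  then show ?thesis by blast
qed

text \<open>Walk from \<open>u\<close> to the cycle, once around it, and back the same way. The two
  trips contribute an even amount to every edge, even if they use edges of the cycle, so the first
  cycle edge stays odd.\<close>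

lemma odd_walk_to_cycle:
  assumes u: "non_wo A u" and C: "has_cycle_in A C" "\<And>v. v \<in> C \<Longrightarrow> (uadj A)\<^sup>*\<^sup>* u v"
  shows "\<exists>L. odd_walks A L \<noteq> {}"
proof -
  obtain xs where xs: "length xs \<ge> 3" "distinct xs" "set xs \<subseteq> C" "successively (uadj A) (xs @ [hd xs])"
    using C(1) unfolding has_cycle_in_iff by blast
  then obtain c y z zs where xs_eq: "xs = c # y # z # zs"
    by (metis One_nat_def Suc_le_length_iff numeral_3_eq_3)
  have "(uadj A)\<^sup>*\<^sup>* u c" using C(2) xs xs_eq by auto
  then obtain p where p: "p \<noteq> []" "hd p = u" "last p = c" "successively (uadj A) p"
    by (rule rtranclp_distinct_walk)
  define p' where "p' = butlast p"
  have p_eq: "p = p' @ [c]" unfolding p'_def using p append_butlast_last_id by fastforce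
  define e where "e = {c, y}"
  define w where "w = p' @ c # y # z # zs @ c # rev p'"
  have rp: "successively (uadj A) (c # rev p')"
    using p(4) by (subst (asm) successively_uadj_rev[symmetric]) (simp add: p_eq del: successively_rev)
  have "successively (uadj A) w"
    using p(4) xs(4) rp
    by (auto simp: w_def p_eq xs_eq successively_append_iff successively_Cons hd_append simp del: successively_rev)
  moreover have "hd w = u" "last w = u"
    using p(2) unfolding w_def p_eq by (auto simp: hd_append last_rev)
  moreover have "odd (edge_count e w)"
  proof -
    have "edge_count e w = edge_count e p + edge_count e (c # y # z # zs @ c # rev p')"
      unfolding w_def p_eq by (rule edge_count_append)
    moreover have "edge_count e (c # y # z # zs @ c # rev p') = edge_count e (c # y # z # zs @ [c]) + edge_count e (c # rev p')"
      using edge_count_append[of e "c # y # z # zs" c "rev p'"] by simp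
    moreover have "edge_count e (c # rev p') = edge_count e p"
      using edge_count_rev[of e p] by (simp add: p_eq)
    moreover have "edge_count e (c # y # z # zs @ [c]) = 1"
    proof -
      have "edge_count e (z # zs @ [c]) = 0"
        using xs(2) edge_count_pos[of e "z # zs @ [c]"] by (auto simp: xs_eq e_def)
      moreover have "{y, z} \<noteq> e" using xs(2) by (auto simp: xs_eq e_def doubleton_eq_iff)
      ultimately show ?thesis by (simp add: e_def)
    qed
    ultimately have "edge_count e w = 2 * edge_count e p + 1" by linarith
    then show ?thesis by simp
  qed
  moreover have "length w = Suc (length w - 1)" by (simp add: w_def)
  ultimately have "w \<in> odd_walks A (length w - 1)"
    using u unfolding odd_walks_def mem_Collect_eq by metis
  then show ?thesis by blast
qed

subsection \<open>The lower bound\<close>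

lemma foldl_bind_pmf:
  "foldl (\<lambda>p a. bind_pmf p (\<lambda>s. step s a)) p xs =
   bind_pmf p (\<lambda>s. foldl (\<lambda>p a. bind_pmf p (\<lambda>s. step s a)) (return_pmf s) xs)"
proof (induction xs arbitrary: p)
  case Nil
  then show ?case by (simp add: bind_return_pmf')
next
  case (Cons a xs)
  show ?case
    using Cons[of "bind_pmf p (\<lambda>s. step s a)"] Cons[of "step _ a"]
    by (simp add: bind_assoc_pmf bind_return_pmf)
qed

text \<open>The communication view: the state after Alice's part is her message, and Bob resumes the
  run from it.\<close>

lemma run1_append:
  "run1 init step out (xs @ ys) =
   bind_pmf (foldl (\<lambda>p a. bind_pmf p (\<lambda>s. step s a)) init xs) (\<lambda>s. run1 (return_pmf s) step out ys)"
  unfolding run1_def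
  by (subst foldl_append, subst foldl_bind_pmf) (simp add: bind_assoc_pmf)

lemma measure_bind_pmf_eq:
  "measure_pmf.prob (bind_pmf p f) X = measure_pmf.expectation p (\<lambda>s. measure_pmf.prob (f s) X)"
proof -
  have "ennreal (measure_pmf.prob (bind_pmf p f) X) = (\<integral>\<^sup>+ s. ennreal (measure_pmf.prob (f s) X) \<partial>p)"
    by (simp add: measure_pmf.emeasure_eq_measure flip: measure_pmf.emeasure_eq_measure)
  also have "\<dots> = ennreal (measure_pmf.expectation p (\<lambda>s. measure_pmf.prob (f s) X))"
    by (intro nn_integral_eq_integral measure_pmf.integrable_const_bound[where B = 1]) auto
  finally show ?thesis by (simp add: integral_nonneg_AE)
qed

lemma set_pmf_foldl:
  assumes "space_bounded S init step"
  shows "set_pmf (foldl (\<lambda>p a. bind_pmf p (\<lambda>s. step s a)) init xs) \<subseteq> {..<2 ^ S}"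
proof (induction xs rule: rev_induct)
  case Nil
  then show ?case using assms by (simp add: space_bounded_def)
next
  case (snoc a xs)
  have "set_pmf (step s a) \<subseteq> {..<2 ^ S}" if "s < 2 ^ S" for s
    using assms that unfolding space_bounded_def by blast
  then show ?case using snoc by (fastforce simp: set_bind_pmf)
qed

lemma measure_pmf_prob_Compl: "measure_pmf.prob p (- X) = 1 - measure_pmf.prob p X"
  using measure_pmf.prob_compl[of X p] by (simp add: Compl_eq_Diff_UNIV)

text \<open>Alice holds a subset \<open>X\<close> of a \<open>k\<close> by \<open>k\<close> grid and
  streams its arcs; Bob streams the rest of the pattern around his index \<open>ij\<close> and
  answers yes if the algorithm reports a copy. Correctness of the algorithm makes this a random
  access code for \<open>k * k\<close> bits.\<close>

lemma index_reduction:
  fixes V :: "'a set" and A :: "('a \<times> 'a) set"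
  assumes solv: "sub_solvable1 V A n S"
    and orient: "oriented V A"
    and x: "minimal_odd_walk A L x" "L \<ge> 1"
    and ab: "(a, b) \<in> A" "{a, b} = {x ! ((L - 1) div 2), x ! Suc ((L - 1) div 2)}"
    and n: "2 * k + card V \<le> n"
  shows "(2::real) ^ (k * k) \<le> real (2 ^ S) * (3 * 2 powr (-2/3)) ^ (k * k)"
proof -
  obtain init step and out :: "nat \<Rightarrow> nat set option pmf"
    where sb: "space_bounded S init step"
      and corr: "\<And>E xs. oriented {..<n} E \<Longrightarrow> distinct xs \<Longrightarrow> set xs = E \<Longrightarrow>
           measure_pmf.prob (run1 init step out xs) {r. sub_correct n V A E r} \<ge> 2 / 3"
    using solv unfolding sub_solvable1_def by blast
  have finV: "finite V" and AV: "A \<subseteq> V \<times> V" and irr: "\<And>v. (v, v) \<notin> A" and asym: "\<And>u v. (u, v) \<in> A \<Longrightarrow> (v, u) \<notin> A"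
    using orient by (auto simp: oriented_def)
  have abV: "a \<in> V" "b \<in> V" "a \<noteq> b" "(b, a) \<notin> A" using ab AV irr asym by auto
  have finA: "finite A" using finV AV finite_subset by blast
  obtain idx where idx: "bij_betw idx V {..<card V}"
    using finV by (metis atLeast0LessThan ex_bij_betw_finite_nat)
  define I where "I = {..<k} \<times> {..<k}"
  define B where "B X = (\<lambda>(i, j). (i, k + j)) ` X" for X :: "(nat \<times> nat) set"
  \<comment> \<open>Vertices below \<open>k\<close> form \<open>P\<close>, the next \<open>k\<close>
    form \<open>Q\<close>, and the pattern vertices other than \<open>a\<close> and \<open>b\<close>
    are numbered from \<open>2 * k\<close> on.\<close>
  define g where "g = (\<lambda>(i, j) v. if v = a then i else if v = b then k + j else 2 * k + idx v)"
  define D where "D ij = map_prod (g ij) (g ij) ` (A - {(a, b)})" for ij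
  have finI: "finite I" by (simp add: I_def)
  \<comment> \<open>Fixed orders of the arcs: Alice's stream may depend on \<open>X\<close> only and
    Bob's on \<open>ij\<close> only.\<close>
  define al where "al X = (SOME xs. set xs = B X \<and> distinct xs)" for X
  define bl where "bl ij = (SOME xs. set xs = D ij \<and> distinct xs)" for ij
  have al: "set (al X) = B X \<and> distinct (al X)" if "X \<subseteq> I" for X
  proof -
    have "finite (B X)" using finite_subset[OF that finI] by (simp add: B_def)
    from finite_distinct_list[OF this] show ?thesis unfolding al_def by (rule someI_ex)
  qed
  have bl: "set (bl ij) = D ij \<and> distinct (bl ij)" for ij
  proof -
    have "finite (D ij)" using finA by (simp add: D_def)
    from finite_distinct_list[OF this] show ?thesis unfolding bl_def by (rule someI_ex)
  qed
  have g_gadget: "gadget A V x L a b {..<k} {k..<2 * k} (B (X - {ij})) (g ij)"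
    and g_le: "g ij ` V \<subseteq> {..<n}"
    if X: "X \<subseteq> I" and ij: "ij \<in> I" for X ij
  proof -
    obtain i j where ij_eq: "ij = (i, j)" by (cases ij)
    have ij': "i < k" "j < k" using ij by (auto simp: ij_eq I_def)
    have idx_inj: "inj_on idx V" and idx_lt: "\<And>v. v \<in> V \<Longrightarrow> idx v < card V"
      using idx by (auto simp: bij_betw_def)
    show "g ij ` V \<subseteq> {..<n}"
      using idx_lt n ij' by (fastforce simp: g_def ij_eq)
    show "gadget A V x L a b {..<k} {k..<2 * k} (B (X - {ij})) (g ij)"
    proof
      show "inj_on (g ij) V"
        using ij' inj_onD[OF idx_inj] by (intro inj_onI) (auto simp: g_def ij_eq split: if_splits)
      show "finite (B (X - {ij}))" using finite_subset[OF X finI] by (simp add: B_def)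
      show "g ij ` (V - {a, b}) \<inter> ({..<k} \<union> {k..<2 * k}) = {}" by (auto simp: g_def ij_eq)
      show "B (X - {ij}) \<subseteq> {..<k} \<times> {k..<2 * k} - {(g ij a, g ij b)}"
        using X abV by (auto simp: B_def g_def ij_eq I_def)
    qed (use orient x ab ij' abV in \<open>auto simp: g_def ij_eq\<close>)
  qed
  define \<beta> where "\<beta> ij s = measure_pmf.prob (run1 (return_pmf s) step out (bl ij)) {r. r \<noteq> None}" for ij s
  define p where "p X = foldl (\<lambda>p a. bind_pmf p (\<lambda>s. step s a)) init (al X)" for X
  have main: "if ij \<in> X then measure_pmf.expectation (p X) (\<beta> ij) \<ge> 2/3 else measure_pmf.expectation (p X) (\<beta> ij) \<le> 1/3"
    if X: "X \<subseteq> I" and ij: "ij \<in> I" for X ij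
  proof -
    \<comment> \<open>The gadget is built with the queried bit switched off. The streamed graph
      \<open>F\<close> is \<open>E\<close> if the bit is 0, and \<open>E\<close> with the additional
      arc \<open>(g ij a, g ij b)\<close> if it is 1.\<close>
    interpret gadget A V x L a b "{..<k}" "{k..<2 * k}" "B (X - {ij})" "g ij"
      by (rule g_gadget[OF X ij])
    define F where "F = B X \<union> D ij"
    have E_eq: "E = B (X - {ij}) \<union> D ij" by (simp add: E_def D_def)
    have gab: "(g ij a, g ij b) = (case ij of (i, j) \<Rightarrow> (i, k + j))"
      using abV by (auto simp: g_def split: prod.splits)
    have disj: "B X \<inter> D ij = {}"
    proof (rule ccontr)
      assume "B X \<inter> D ij \<noteq> {}"
      then obtain u v where uv: "(u, v) \<in> A - {(a, b)}" "(g ij u, g ij v) \<in> B X"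
        by (auto simp: D_def)
      then have "g ij u < k" "k \<le> g ij v" "g ij v < 2 * k" using X by (auto simp: B_def I_def)
      moreover have "u \<in> V" "v \<in> V" using uv AV by auto
      ultimately have "u = a" "v = b" using g(2-4) by (fastforce simp: g_def split: prod.splits if_splits)+
      then show False using uv by simp
    qed
    have FB: "F \<subseteq> insert (g ij a, g ij b) E"
    proof -
      have "B X \<subseteq> insert (case ij of (i, j) \<Rightarrow> (i, k + j)) (B (X - {ij}))"
        unfolding B_def by blast
      then show ?thesis unfolding F_def E_eq gab by blast
    qed
    have Fn: "F \<subseteq> {..<n} \<times> {..<n}"
      using X g_le[OF X ij] AV n by (fastforce simp: F_def B_def D_def I_def)
    \<comment> \<open>The collapse is a homomorphism on \<open>F\<close> too, since the possible
      extra arc goes to \<open>(a, b)\<close>. A loop or an antiparallel pair in \<open>F\<close>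
      would thus give one in \<open>A\<close>.\<close>
    have proj_F: "(proj u, proj v) \<in> A" if "(u, v) \<in> F" for u v
      using that FB proj_arc ab abV by auto
    have "oriented {..<n} F"
      unfolding oriented_def using Fn proj_F irr asym by blast
    moreover have "distinct (al X @ bl ij)" "set (al X @ bl ij) = F"
      using al[OF X] bl disj by (auto simp: F_def)
    ultimately have "2/3 \<le> measure_pmf.prob (run1 init step out (al X @ bl ij)) {r. sub_correct n V A F r}"
      by (rule corr)
    also have "\<dots> = measure_pmf.expectation (p X) (\<lambda>s. measure_pmf.prob (run1 (return_pmf s) step out (bl ij)) {r. sub_correct n V A F r})"
      unfolding run1_append measure_bind_pmf_eq p_def ..
    finally have two_thirds: "2/3 \<le> \<dots>" .
    have int: "integrable (measure_pmf (p X)) (\<lambda>s. measure_pmf.prob (run1 (return_pmf s) step out (bl ij)) R)" for R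
      by (rule measure_pmf.integrable_const_bound[where B = 1]) auto
    show ?thesis
    proof (cases "ij \<in> X")
      case True
      have gab_F: "(g ij a, g ij b) \<in> F" using True unfolding gab F_def B_def by blast
      have ab_in_F: "\<forall>(u, v)\<in>A. (g ij u, g ij v) \<in> F"
      proof clarify
        fix u v assume "(u, v) \<in> A"
        show "(g ij u, g ij v) \<in> F"
        proof (cases "(u, v) = (a, b)")
          case True
          then show ?thesis using gab_F by simp
        next
          case False
          then have "map_prod (g ij) (g ij) (u, v) \<in> D ij"
            unfolding D_def using \<open>(u, v) \<in> A\<close> by blast
          then show ?thesis by (simp add: F_def)
        qed
      qed
      have "is_copy n V A F (g ij)"
        using g(1) g_le[OF X ij] ab_in_F unfolding is_copy_def by blast
      then have "{r. sub_correct n V A F r} \<subseteq> {r. r \<noteq> None}"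
        by (auto simp: sub_correct_def split: option.splits)
      then have "measure_pmf.expectation (p X) (\<lambda>s. measure_pmf.prob (run1 (return_pmf s) step out (bl ij)) {r. sub_correct n V A F r})
        \<le> measure_pmf.expectation (p X) (\<beta> ij)"
        unfolding \<beta>_def by (intro integral_mono int measure_pmf.finite_measure_mono) auto
      then show ?thesis using two_thirds True by simp
    next
      case False
      then have "X - {ij} = X" by simp
      then have "F = E" unfolding F_def E_eq by (rule arg_cong[of _ _ "\<lambda>X. B X \<union> D ij", symmetric])
      then have "{r. sub_correct n V A F r} \<subseteq> - {r. r \<noteq> None}"
        using no_copy by (auto simp: sub_correct_def split: option.splits)
      then have "measure_pmf.expectation (p X) (\<lambda>s. measure_pmf.prob (run1 (return_pmf s) step out (bl ij)) {r. sub_correct n V A F r})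
        \<le> measure_pmf.expectation (p X) (\<lambda>s. measure_pmf.prob (run1 (return_pmf s) step out (bl ij)) (- {r. r \<noteq> None}))"
        by (intro integral_mono int measure_pmf.finite_measure_mono) auto
      also have "\<dots> = measure_pmf.expectation (p X) (\<lambda>s. 1 - \<beta> ij s)"
        unfolding \<beta>_def by (subst measure_pmf_prob_Compl) (rule refl)
      also have "\<dots> = 1 - measure_pmf.expectation (p X) (\<beta> ij)"
        unfolding \<beta>_def by (subst Bochner_Integration.integral_diff) (use int in \<open>auto simp del: not_None_eq\<close>)
      finally show ?thesis using two_thirds False by simp
    qed
  qed
  have "(2::real) ^ card I \<le> real (2 ^ S) * (3 * 2 powr (-2/3)) ^ card I"
  proof (rule random_access_code_bound[OF finI, where p = p and \<beta> = \<beta>])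
    show "set_pmf (p X) \<subseteq> {..<2 ^ S}" for X
      unfolding p_def by (rule set_pmf_foldl[OF sb])
    show "0 \<le> \<beta> i s" "\<beta> i s \<le> 1" for i s by (simp_all add: \<beta>_def)
    show "2 / 3 \<le> measure_pmf.expectation (p X) (\<beta> i)" if "X \<subseteq> I" "i \<in> X" for X i
      using main[of X i] that by auto
    show "measure_pmf.expectation (p X) (\<beta> i) \<le> 1/3" if "X \<subseteq> I" "i \<in> I - X" for X i
      using main[of X i] that by auto
  qed
  then show ?thesis by (simp add: I_def)
qed

lemma R1_Omega_n2_if_odd_walk:
  assumes orient: "oriented V A" and w: "odd_walks A L \<noteq> {}"
  shows "R1_Omega_n2 V A"
proof -
  define L0 where "L0 = (LEAST L. odd_walks A L \<noteq> {})"
  have L0: "odd_walks A L0 \<noteq> {}" "\<And>L'. L' < L0 \<Longrightarrow> odd_walks A L' = {}"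
    unfolding L0_def using w LeastI[of "\<lambda>L. odd_walks A L \<noteq> {}"] not_less_Least by blast+
  then obtain x where x: "minimal_odd_walk A L0 x" by (auto simp: minimal_odd_walk_def)
  then have xo: "length x = Suc L0" "successively (uadj A) x" "\<exists>e. odd (edge_count e x)"
    by (auto simp: minimal_odd_walk_def odd_walks_def)
  have L1: "L0 \<ge> 1"
  proof (rule ccontr)
    assume "\<not> L0 \<ge> 1"
    then have "length x = 1" using xo(1) by simp
    then obtain y where "x = [y]" by (auto simp: length_Suc_conv)
    then show False using xo(3) by simp
  qed
  let ?m = "(L0 - 1) div 2"
  have "x = take ?m x @ x ! ?m # x ! Suc ?m # drop (Suc (Suc ?m)) x"
    using xo L1 by (simp add: id_take_nth_drop Cons_nth_drop_Suc)
  then have "uadj A (x ! ?m) (x ! Suc ?m)"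
    using xo(2) by (metis successively.simps(3) successively_append_iff)
  then obtain a b where ab: "(a, b) \<in> A" "{a, b} = {x ! ?m, x ! Suc ?m}"
    by (auto simp: uadj_def)
  let ?c = "5/3 - log 2 3 :: real"
  have c0: "?c > 0" by (rule random_access_code_space(2)[of 0 0]) simp
  have "real S \<ge> ?c / 16 * real n ^ 2" if n: "n \<ge> 2 * card V + 4" and S: "sub_solvable1 V A n S" for n S
  proof -
    \<comment> \<open>The largest grid for which both sides and a copy of the pattern fit into
      \<open>n\<close> vertices. The bound on \<open>n\<close> ensures \<open>n \<le> 4 * k\<close>,
      whence the factor 16.\<close>
    define k where "k = (n - card V) div 2"
    have "2 * k + card V \<le> n" using n by (simp add: k_def)
    from index_reduction[OF S orient x L1 ab this]
    have "real S \<ge> ?c * real (k * k)" by (rule random_access_code_space(1))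
    moreover have "n \<le> 4 * k" using n unfolding k_def by linarith
    then have "n * n \<le> (4 * k) * (4 * k)" by (intro mult_mono) auto
    then have "real (n * n) \<le> real (4 * k * (4 * k))" by (simp only: of_nat_le_iff)
    then have "real n ^ 2 \<le> 16 * real (k * k)" by (simp add: power2_eq_square)
    then have "?c / 16 * real n ^ 2 \<le> ?c / 16 * (16 * real (k * k))"
      using c0 by (intro mult_left_mono) auto
    ultimately show ?thesis by simp
  qed
  then show ?thesis unfolding R1_Omega_n2_def using c0 by (intro exI[of _ "?c / 16"]) auto
qed

subsection \<open>Sparse kernels for trees\<close>

definition thick :: "nat \<Rightarrow> ('a \<times> 'a) set \<Rightarrow> bool" where
  "thick K S \<longleftrightarrow> (\<forall>(u, v) \<in> S. K \<le> card (S `` {u}) \<and> K \<le> card (S\<inverse> `` {v}))"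

text \<open>Split every vertex into a tail and a head copy; this is the \<open>K\<close>-core of the
  resulting bipartite graph. Only out-degrees of tails and in-degrees of heads matter, as a moved
  vertex is left only in the direction given by its role.\<close>

definition core :: "nat \<Rightarrow> ('a \<times> 'a) set \<Rightarrow> ('a \<times> 'a) set" where
  "core K F = \<Union> {S. S \<subseteq> F \<and> thick K S}"

definition cored :: "nat \<Rightarrow> ('a \<times> 'a) set \<Rightarrow> 'a \<times> 'a \<Rightarrow> bool" where
  "cored K F e \<longleftrightarrow> fst e \<in> Domain (core K F) \<and> snd e \<in> Range (core K F)"

text \<open>In the split bipartite graph this is \<open>K\<close>-degeneracy: there is no nonempty
  \<open>(K + 1)\<close>-core.\<close>

definition sparse :: "nat \<Rightarrow> ('a \<times> 'a) set \<Rightarrow> bool" where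
  "sparse K F \<longleftrightarrow> (\<forall>S \<subseteq> F. thick (Suc K) S \<longrightarrow> S = {})"

lemma core_subset: "core K F \<subseteq> F"
  by (auto simp: core_def)

lemma core_mono: "F \<subseteq> F' \<Longrightarrow> core K F \<subseteq> core K F'"
  by (auto simp: core_def)

lemma cored_mono: "F \<subseteq> F' \<Longrightarrow> cored K F e \<Longrightarrow> cored K F' e"
  unfolding cored_def using core_mono by blast

lemma thick_core:
  assumes "finite F"
  shows "thick K (core K F)"
  unfolding thick_def
proof clarify
  fix u v assume "(u, v) \<in> core K F"
  then obtain S where S: "S \<subseteq> F" "thick K S" "(u, v) \<in> S" by (auto simp: core_def)
  then have sub: "S \<subseteq> core K F" by (auto simp: core_def)
  have fin: "finite (core K F)" using assms core_subset finite_subset by blast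
  have "K \<le> card (S `` {u})" "K \<le> card (S\<inverse> `` {v})" using S by (auto simp: thick_def)
  moreover have "card (S `` {u}) \<le> card (core K F `` {u})" "card (S\<inverse> `` {v}) \<le> card ((core K F)\<inverse> `` {v})"
    using sub fin by (auto intro!: card_mono finite_Image)
  ultimately show "K \<le> card (core K F `` {u}) \<and> K \<le> card ((core K F)\<inverse> `` {v})" by linarith
qed

text \<open>Deleting \<open>e\<close> from a \<open>(K + 1)\<close>-thick set lowers each degree by
  at most one. What remains is \<open>K\<close>-thick, hence inside the core of \<open>F\<close>,
  and by \<open>K \<ge> 1\<close> it still has arcs at both ends of \<open>e\<close>; so
  \<open>e\<close> would have been cored.\<close>

lemma sparse_insert:
  assumes fin: "finite F" and sp: "sparse K F" and nc: "\<not> cored K F e" and K: "K \<ge> 1"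
  shows "sparse K (insert e F)"
  unfolding sparse_def
proof (intro allI impI)
  fix S assume S: "S \<subseteq> insert e F" "thick (Suc K) S"
  show "S = {}"
  proof (cases "e \<in> S")
    case False
    then show ?thesis using S sp by (auto simp: sparse_def)
  next
    case True
    define S' where "S' = S - {e}"
    have finS: "finite S" using S(1) fin finite_subset by blast
    have deg: "K \<le> card (S' `` {u})" "K \<le> card (S'\<inverse> `` {v})" if uv: "(u, v) \<in> S" for u v
    proof -
      have fS': "finite (S' `` {u})" "finite (S'\<inverse> `` {v})"
        using finS by (auto simp: S'_def intro!: finite_Image)
      have "Suc K \<le> card (S `` {u})" "Suc K \<le> card (S\<inverse> `` {v})"
        using S(2) uv by (auto simp: thick_def)
      moreover have "card (S `` {u}) \<le> card (insert (snd e) (S' `` {u}))"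
        "card (S\<inverse> `` {v}) \<le> card (insert (fst e) (S'\<inverse> `` {v}))"
        using fS' by (auto intro!: card_mono simp: S'_def)
      moreover have "card (insert (snd e) (S' `` {u})) \<le> Suc (card (S' `` {u}))"
        "card (insert (fst e) (S'\<inverse> `` {v})) \<le> Suc (card (S'\<inverse> `` {v}))"
        by (rule card_insert_le_m1; simp)+
      ultimately show "K \<le> card (S' `` {u})" "K \<le> card (S'\<inverse> `` {v})" by linarith+
    qed
    then have "thick K S'" by (auto simp: thick_def S'_def)
    moreover have "S' \<subseteq> F" using S(1) by (auto simp: S'_def)
    ultimately have sub: "S' \<subseteq> core K F" unfolding core_def by blast
    have "(fst e, snd e) \<in> S" using True by simp
    from deg[OF this] K have "S' `` {fst e} \<noteq> {}" "S'\<inverse> `` {snd e} \<noteq> {}" by force+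
    then have "cored K F e" using sub unfolding cored_def by blast
    then show ?thesis using nc by simp
  qed
qed

lemma sparse_subset: "sparse K F \<Longrightarrow> F' \<subseteq> F \<Longrightarrow> sparse K F'"
  unfolding sparse_def by blast

text \<open>Peeling: some tail or head has at most \<open>K\<close> arcs, and deleting them removes
  one element from the domain or the range.\<close>

lemma card_sparse_le:
  assumes "finite F" "sparse K F"
  shows "card F \<le> K * (card (Domain F) + card (Range F))"
  using assms
proof (induction F rule: finite_psubset_induct)
  case (psubset F)
  show ?case
  proof (cases "F = {}")
    case False
    then have "\<not> thick (Suc K) F" using psubset.prems by (auto simp: sparse_def)
    then obtain u v where uv: "(u, v) \<in> F" and "\<not> (Suc K \<le> card (F `` {u}) \<and> Suc K \<le> card (F\<inverse> `` {v}))"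
      unfolding thick_def by blast
    then have le: "card (F `` {u}) \<le> K \<or> card (F\<inverse> `` {v}) \<le> K" by linarith
    have finDR: "finite (Domain F)" "finite (Range F)" using psubset.hyps by (auto simp: finite_Domain finite_Range)
    from le show ?thesis
    proof
      assume le: "card (F `` {u}) \<le> K"
      define F' where "F' = {e \<in> F. fst e \<noteq> u}"
      have "F' \<subseteq> F" "(u, v) \<notin> F'" by (auto simp: F'_def)
      then have "F' \<subset> F" using uv by blast
      then have IH: "card F' \<le> K * (card (Domain F') + card (Range F'))"
        using psubset sparse_subset by blast
      have "F = F' \<union> Pair u ` (F `` {u})" by (auto simp: F'_def)
      then have "card F \<le> card F' + card (Pair u ` (F `` {u}))" by (metis card_Un_le)
      also have "card (Pair u ` (F `` {u})) \<le> K"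
        using le psubset.hyps card_image_le[of "F `` {u}" "Pair u"] by (auto intro: finite_Image)
      finally have "card F \<le> card F' + K" by simp
      moreover have "card (Range F') \<le> card (Range F)"
        using finDR by (intro card_mono) (auto simp: F'_def)
      moreover have "Domain F' \<subset> Domain F" using uv unfolding F'_def by force
      then have "Suc (card (Domain F')) \<le> card (Domain F)"
        using finDR psubset_card_mono by (metis Suc_leI)
      ultimately have "card F \<le> K * (card (Domain F') + card (Range F')) + K"
        and "K * (Suc (card (Domain F')) + card (Range F')) \<le> K * (card (Domain F) + card (Range F))"
        using IH by (linarith, intro mult_le_mono2) linarith
      then show ?thesis by simp
    next
      assume le: "card (F\<inverse> `` {v}) \<le> K"
      define F' where "F' = {e \<in> F. snd e \<noteq> v}"
      have "F' \<subseteq> F" "(u, v) \<notin> F'" by (auto simp: F'_def)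
      then have "F' \<subset> F" using uv by blast
      then have IH: "card F' \<le> K * (card (Domain F') + card (Range F'))"
        using psubset sparse_subset by blast
      have "F = F' \<union> (\<lambda>w. (w, v)) ` (F\<inverse> `` {v})" by (auto simp: F'_def)
      then have "card F \<le> card F' + card ((\<lambda>w. (w, v)) ` (F\<inverse> `` {v}))" by (metis card_Un_le)
      also have "card ((\<lambda>w. (w, v)) ` (F\<inverse> `` {v})) \<le> K"
        using le psubset.hyps card_image_le[of "F\<inverse> `` {v}" "\<lambda>w. (w, v)"] by (auto intro: finite_Image)
      finally have "card F \<le> card F' + K" by simp
      moreover have "card (Domain F') \<le> card (Domain F)"
        using finDR by (intro card_mono) (auto simp: F'_def)
      moreover have "Range F' \<subset> Range F" using uv unfolding F'_def by force
      then have "Suc (card (Range F')) \<le> card (Range F)"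
        using finDR psubset_card_mono by (metis Suc_leI)
      ultimately have "card F \<le> K * (card (Domain F') + card (Range F')) + K"
        and "K * (card (Domain F') + Suc (card (Range F'))) \<le> K * (card (Domain F) + card (Range F))"
        using IH by (linarith, intro mult_le_mono2) linarith
      then show ?thesis by simp
    qed
  qed simp
qed

section \<open>Rerouting copies of trees through the core\<close>

lemma tree_growth_induct:
  fixes A :: "('a \<times> 'a) set"
  assumes finV: "finite V" and AV: "A \<subseteq> V \<times> V" and acyc: "\<not> has_cycle_in A V" and NV: "N \<subseteq> V"
    and sep: "\<And>u v. u \<in> N \<Longrightarrow> v \<in> N \<Longrightarrow> (uadj A)\<^sup>*\<^sup>* u v \<Longrightarrow> u = v"
    and base: "P N"
    and step: "\<And>D y p. N \<subseteq> D \<Longrightarrow> D \<subseteq> V \<Longrightarrow> y \<in> V - D \<Longrightarrow> {x \<in> D. uadj A x y} \<subseteq> {p} \<Longrightarrow> P D \<Longrightarrow> P (insert y D)"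
  shows "P V"
proof -
  \<comment> \<open>The invariant of the growth: vertices of \<open>D\<close> that are connected at
    all are connected inside \<open>D\<close>. A new vertex with two neighbours in \<open>D\<close>
    would then close a cycle. \<open>N\<close> satisfies it because distinct members of
    \<open>N\<close> are never connected.\<close>
  define conn where "conn D \<longleftrightarrow> (\<forall>u \<in> D. \<forall>v \<in> D. (uadj A)\<^sup>*\<^sup>* u v \<longrightarrow> (\<lambda>u v. uadj A u v \<and> u \<in> D \<and> v \<in> D)\<^sup>*\<^sup>* u v)" for D
  have sym: "(uadj A)\<^sup>*\<^sup>* u v \<Longrightarrow> (uadj A)\<^sup>*\<^sup>* v u" for u v
    by (metis symp_rtranclp sympD sympI uadj_sym)
  have symD: "(\<lambda>u v. uadj A u v \<and> u \<in> D \<and> v \<in> D)\<^sup>*\<^sup>* u v \<Longrightarrow> (\<lambda>u v. uadj A u v \<and> u \<in> D \<and> v \<in> D)\<^sup>*\<^sup>* v u" for D u v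
    by (rule sympD[OF symp_rtranclp]) (auto intro: sympI uadj_sym)
  have monoD: "(\<lambda>u v. uadj A u v \<and> u \<in> D \<and> v \<in> D)\<^sup>*\<^sup>* u v \<Longrightarrow> D \<subseteq> D' \<Longrightarrow> (\<lambda>u v. uadj A u v \<and> u \<in> D' \<and> v \<in> D')\<^sup>*\<^sup>* u v" for D D' u v
    by (erule rtranclp_mono[THEN predicate2D, rotated]) auto
  have "N \<subseteq> D \<Longrightarrow> D \<subseteq> V \<Longrightarrow> P D \<Longrightarrow> conn D \<Longrightarrow> P V" for D
  proof (induction "card (V - D)" arbitrary: D rule: less_induct)
    case less
    show ?case
    proof (cases "D = V")
      case False
      have grow: "P V" if y: "y \<in> V - D" and sub: "{x \<in> D. uadj A x y} \<subseteq> {p}" and c: "conn (insert y D)" for y p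
      proof (rule less.hyps)
        show "card (V - insert y D) < card (V - D)"
          using y finV by (intro psubset_card_mono) auto
        show "P (insert y D)" using step[OF less.prems(1,2) y sub less.prems(3)] .
      qed (use y c less.prems in auto)
      have connI: "conn (insert y D)"
        if *: "\<And>v. v \<in> D \<Longrightarrow> (uadj A)\<^sup>*\<^sup>* y v \<Longrightarrow> (\<lambda>u v. uadj A u v \<and> u \<in> insert y D \<and> v \<in> insert y D)\<^sup>*\<^sup>* y v" for y
        unfolding conn_def
      proof (intro ballI impI)
        fix u v assume uv: "u \<in> insert y D" "v \<in> insert y D" "(uadj A)\<^sup>*\<^sup>* u v"
        consider "u \<in> D" "v \<in> D" | "u = y" "v = y" | "u = y" "v \<in> D" | "u \<in> D" "v = y" using uv by blast
        then show "(\<lambda>u v. uadj A u v \<and> u \<in> insert y D \<and> v \<in> insert y D)\<^sup>*\<^sup>* u v"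
        proof cases
          case 1
          then show ?thesis using less.prems(4) uv(3) monoD[of D u v "insert y D"] by (auto simp: conn_def)
        next
          case 4
          then show ?thesis using *[OF 4(1)] sym[OF uv(3)] symD by blast
        qed (use * uv in auto)
      qed
      show ?thesis
      proof (cases "\<exists>y \<in> V - D. \<exists>p \<in> D. uadj A p y")
        case True
        then obtain y p where yp: "y \<in> V - D" "p \<in> D" "uadj A p y" by blast
        show ?thesis
        proof (rule grow[OF yp(1)])
          show "{x \<in> D. uadj A x y} \<subseteq> {p}"
          proof (rule ccontr)
            assume "\<not> ?thesis"
            then obtain q where q: "q \<in> D" "uadj A q y" "q \<noteq> p" by blast
            have "(uadj A)\<^sup>*\<^sup>* p q" using yp(3) uadj_sym[OF q(2)] by (meson r_into_rtranclp rtranclp.rtrancl_into_rtrancl)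
            then have "(\<lambda>u v. uadj A u v \<and> u \<in> D \<and> v \<in> D)\<^sup>*\<^sup>* p q"
              using less.prems(4) yp q by (auto simp: conn_def)
            then obtain xs where xs: "xs \<noteq> []" "hd xs = p" "last xs = q"
              "successively (\<lambda>u v. uadj A u v \<and> u \<in> D \<and> v \<in> D) xs" "distinct xs"
              by (rule rtranclp_distinct_walk)
            obtain z zs where z: "xs = p # z # zs"
              using xs q(3) by (metis last.simps list.exhaust_sel)
            have setD: "set xs \<subseteq> D"
            proof -
              have "successively (\<lambda>u v. uadj A u v \<and> u \<in> D \<and> v \<in> D) ys \<Longrightarrow> hd ys \<in> D \<Longrightarrow> set ys \<subseteq> D" for ys
                by (induction ys) (auto simp: successively_Cons)
              then show ?thesis using xs yp by simp
            qed
            have "successively (uadj A) xs" using xs(4) by (rule successively_mono) auto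
            then have "successively (uadj A) ((xs @ [y]) @ [hd (xs @ [y])])"
              using xs(1-3) q(2) uadj_sym[OF yp(3)] by (auto simp: successively_append_iff)
            moreover have "distinct (xs @ [y])" "set (xs @ [y]) \<subseteq> V" "length (xs @ [y]) \<ge> 3"
              using xs(5) setD yp less.prems(2) z by auto
            ultimately have "has_cycle_in A V" unfolding has_cycle_in_iff by blast
            then show False using acyc by simp
          qed
          show "conn (insert y D)"
          proof (rule connI)
            fix v assume v: "v \<in> D" "(uadj A)\<^sup>*\<^sup>* y v"
            have "(uadj A)\<^sup>*\<^sup>* p v" using yp(3) v(2) by (rule converse_rtranclp_into_rtranclp)
            then have "(\<lambda>u v. uadj A u v \<and> u \<in> D \<and> v \<in> D)\<^sup>*\<^sup>* p v"
              using less.prems(4) yp v by (auto simp: conn_def)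
            then have "(\<lambda>u v. uadj A u v \<and> u \<in> insert y D \<and> v \<in> insert y D)\<^sup>*\<^sup>* p v"
              by (rule monoD) auto
            moreover have "uadj A y p \<and> y \<in> insert y D \<and> p \<in> insert y D" using yp uadj_sym by auto
            ultimately show "(\<lambda>u v. uadj A u v \<and> u \<in> insert y D \<and> v \<in> insert y D)\<^sup>*\<^sup>* y v"
              using converse_rtranclp_into_rtranclp[of "\<lambda>u v. uadj A u v \<and> u \<in> insert y D \<and> v \<in> insert y D" y p v]
              by simp
          qed
        qed
      next
        \<comment> \<open>\<open>D\<close> is a union of components, so any remaining vertex may
          start a new one; the set of earlier neighbours is empty.\<close>
        case none: False
        obtain y where y: "y \<in> V - D" using False less.prems(2) by blast
        show ?thesis
        proof (rule grow[OF y])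
          show "{x \<in> D. uadj A x y} \<subseteq> {y}" using none y by blast
          have "v \<in> D" if "(uadj A)\<^sup>*\<^sup>* u v" "u \<in> D" for u v
            using that
          proof (induction rule: rtranclp_induct)
            case (step v w)
            moreover have "w \<in> V" using step.hyps(2) AV by (auto simp: uadj_def)
            ultimately show ?case using none by blast
          qed
          then show "conn (insert y D)" using y sym by (intro connI) blast
        qed
      qed
    qed (use less in simp)
  qed
  moreover have "conn N" using sep by (auto simp: conn_def)
  ultimately show ?thesis using NV base by blast
qed

text \<open>Each vertex either keeps its image under the given copy \<open>f\<close> or is moved into the core \<open>S\<close>.
  Moved vertices avoid all of \<open>f ` V\<close>, so that later vertices may still keep their image.\<close>
definition tree_embed where
  "tree_embed A F S V f D g \<longleftrightarrow> inj_on g D \<and> g ` D \<subseteq> f ` V \<union> Field F \<and>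
     (\<forall>u \<in> D. \<forall>v \<in> D. (u, v) \<in> A \<longrightarrow> (g u, g v) \<in> F) \<and>
     (\<forall>x \<in> D. g x = f x \<or> g x \<notin> f ` V \<and> (x \<in> Domain A \<longrightarrow> g x \<in> Domain S) \<and> (x \<in> Range A \<longrightarrow> g x \<in> Range S))"

lemma tree_embed_converse:
  "tree_embed (A\<inverse>) (F\<inverse>) (S\<inverse>) V f D g \<longleftrightarrow> tree_embed A F S V f D g"
  by (auto simp: tree_embed_def Field_converse)

text \<open>If \<open>p\<close> still has its image and the arc of the copy is stored,
  \<open>y\<close> keeps its image as well. Otherwise \<open>g p\<close> is a tail of the core,
  either because \<open>p\<close> was moved or because the arc was discarded, and its at least
  \<open>2 * card V\<close> core successors outnumber the forbidden vertices. As \<open>y\<close> is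
  only a head, its new image just has to be a head of the core.\<close>

lemma tree_embed_arc:
  assumes finV: "finite V" and A: "oriented V A" and f: "inj_on f V" "\<And>u v. (u, v) \<in> A \<Longrightarrow> (f u, f v) \<in> E"
    and S: "S \<subseteq> F" "thick K S" "finite S" "2 * card V \<le> K"
    and kern: "\<And>u v. (u, v) \<in> E - F \<Longrightarrow> u \<in> Domain S \<and> v \<in> Range S"
    and D: "D \<subseteq> V" "y \<in> V - D" "{x \<in> D. uadj A x y} \<subseteq> {p}"
    and p: "p \<in> D" "(p, y) \<in> A" and y: "\<not> non_wo A y"
    and g: "tree_embed A F S V f D g"
  shows "\<exists>g. tree_embed A F S V f (insert y D) g"
proof -
  have gi: "inj_on g D" "g ` D \<subseteq> f ` V \<union> Field F"
    and ga: "\<And>u v. u \<in> D \<Longrightarrow> v \<in> D \<Longrightarrow> (u, v) \<in> A \<Longrightarrow> (g u, g v) \<in> F"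
    and gt: "\<And>x. x \<in> D \<Longrightarrow> g x = f x \<or> g x \<notin> f ` V \<and> (x \<in> Domain A \<longrightarrow> g x \<in> Domain S) \<and> (x \<in> Range A \<longrightarrow> g x \<in> Range S)"
    using g by (auto simp: tree_embed_def)
  have yA: "y \<notin> Domain A" using y p(2) by (auto simp: non_wo_def)
  have only: "u = p" if "u \<in> D" "(u, y) \<in> A" for u using D(3) that by (auto simp: uadj_def)
  have ext: "tree_embed A F S V f (insert y D) (g(y := z))"
    if z: "z \<notin> g ` D" "(g p, z) \<in> F" "z = f y \<or> z \<notin> f ` V \<and> z \<in> Range S" for z
    unfolding tree_embed_def
  proof (intro conjI ballI impI)
    show "inj_on (g(y := z)) (insert y D)"
      using gi(1) z(1) D(2) by (auto simp: inj_on_def)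
    show "(g(y := z)) ` insert y D \<subseteq> f ` V \<union> Field F"
      using gi(2) z(2) D(2) by (auto simp: Field_def)
    show "((g(y := z)) u, (g(y := z)) v) \<in> F" if "u \<in> insert y D" "v \<in> insert y D" "(u, v) \<in> A" for u v
      using that ga only yA z(2) by auto
    show "(g(y := z)) x = f x \<or> (g(y := z)) x \<notin> f ` V \<and>
        (x \<in> Domain A \<longrightarrow> (g(y := z)) x \<in> Domain S) \<and> (x \<in> Range A \<longrightarrow> (g(y := z)) x \<in> Range S)"
      if "x \<in> insert y D" for x
      using that gt z(3) yA by auto
  qed
  show ?thesis
  proof (cases "g p = f p \<and> (f p, f y) \<in> F")
    case True
    \<comment> \<open>Moved vertices avoid the image of \<open>f\<close>, and unmoved ones differ
      from \<open>f y\<close> by injectivity.\<close>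
    have "f y \<notin> g ` D"
    proof
      assume "f y \<in> g ` D"
      then obtain x where x: "x \<in> D" "g x = f y" by auto
      then have "g x = f x" using gt[OF x(1)] D(2) by auto
      then show False using x D f(1) by (metis DiffD1 DiffD2 inj_onD subsetD)
    qed
    then show ?thesis using ext[of "f y"] True by auto
  next
    case False
    have "g p \<in> Domain S"
    proof (cases "g p = f p")
      case True
      then show ?thesis using False f(2)[OF p(2)] kern by auto
    next
      case False
      then show ?thesis using gt[OF p(1)] p(2) by auto
    qed
    then have "K \<le> card (S `` {g p})" using S(2) by (auto simp: thick_def)
    moreover have "card (f ` V \<union> g ` D) < 2 * card V"
    proof -
      have "card (g ` D) \<le> card D" "card (f ` V) \<le> card V"
        using finV D(1) by (auto intro!: card_image_le intro: finite_subset)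
      moreover have "card D < card V" using finV D by (intro psubset_card_mono) auto
      ultimately show ?thesis using card_Un_le[of "f ` V" "g ` D"] by linarith
    qed
    ultimately have "card (f ` V \<union> g ` D) < card (S `` {g p})" using S(4) by linarith
    moreover have "finite (f ` V \<union> g ` D)" using finV D(1) finite_subset by auto
    ultimately have "\<not> S `` {g p} \<subseteq> f ` V \<union> g ` D" by (meson card_mono leD)
    then obtain z where "(g p, z) \<in> S" "z \<notin> f ` V" "z \<notin> g ` D" by auto
    then show ?thesis using ext[of z] S(1) by auto
  qed
qed

lemma non_wo_converse [simp]: "non_wo (A\<inverse>) v = non_wo A v"
  by (auto simp: non_wo_def)

lemma uadj_converse [simp]: "uadj (A\<inverse>) = uadj A"
  by (auto simp: uadj_def fun_eq_iff)

text \<open>Start from the non-well-oriented vertices at their original images and grow outwards.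
  They are never moved, so every vertex that may be moved has a single role in the core.\<close>

lemma tree_copy_in_kernel:
  assumes A: "oriented V A" and acyc: "\<not> has_cycle_in A V"
    and sep: "\<And>u v. u \<in> V \<Longrightarrow> v \<in> V \<Longrightarrow> non_wo A u \<Longrightarrow> non_wo A v \<Longrightarrow> (uadj A)\<^sup>*\<^sup>* u v \<Longrightarrow> u = v"
    and f: "inj_on f V" "\<And>u v. (u, v) \<in> A \<Longrightarrow> (f u, f v) \<in> E"
    and F: "finite F" "2 * card V \<le> K" "\<And>e. e \<in> E - F \<Longrightarrow> cored K F e"
  shows "\<exists>g. inj_on g V \<and> g ` V \<subseteq> f ` V \<union> Field F \<and> (\<forall>(u, v) \<in> A. (g u, g v) \<in> F)"
proof -
  have finV: "finite V" and AV: "A \<subseteq> V \<times> V" using A by (auto simp: oriented_def)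
  have A': "oriented V (A\<inverse>)" using A by (auto simp: oriented_def)
  define S where "S = core K F"
  have S: "S \<subseteq> F" "thick K S" "finite S"
    unfolding S_def using core_subset thick_core[OF F(1)] finite_subset[OF core_subset F(1)] by auto
  then have S': "S\<inverse> \<subseteq> F\<inverse>" "thick K (S\<inverse>)" "finite (S\<inverse>)"
    by (auto simp: thick_def)
  have kern: "u \<in> Domain S \<and> v \<in> Range S" if "(u, v) \<in> E - F" for u v
    using F(3)[OF that] by (simp add: cored_def S_def)
  define N where "N = {v \<in> V. non_wo A v}"
  have "\<exists>g. tree_embed A F S V f V g"
  proof (rule tree_growth_induct[where P = "\<lambda>D. \<exists>g. tree_embed A F S V f D g" and A = A and N = N])
    show "\<exists>g. tree_embed A F S V f N g"
    proof
      have "(u, v) \<notin> A" if "u \<in> N" "v \<in> N" for u v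
      proof
        assume "(u, v) \<in> A"
        then have "(uadj A)\<^sup>*\<^sup>* u v" by (intro r_into_rtranclp) (simp add: uadj_def)
        then have "u = v" using that sep by (simp add: N_def)
        then show False using \<open>(u, v) \<in> A\<close> A by (auto simp: oriented_def)
      qed
      then show "tree_embed A F S V f N f"
        using inj_on_subset[OF f(1), of N] by (auto simp: tree_embed_def N_def)
    qed
    fix D y p
    assume D: "N \<subseteq> D" "D \<subseteq> V" "y \<in> V - D" "{x \<in> D. uadj A x y} \<subseteq> {p}"
      and "\<exists>g. tree_embed A F S V f D g"
    then obtain g where g: "tree_embed A F S V f D g" by blast
    have y: "\<not> non_wo A y" using D by (auto simp: N_def)
    consider "p \<in> D" "(p, y) \<in> A" | "p \<in> D" "(y, p) \<in> A" | "{x \<in> D. uadj A x y} = {}"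
      using D(4) by (auto simp: uadj_def)
    then show "\<exists>g. tree_embed A F S V f (insert y D) g"
    proof cases
      case 1
      then show ?thesis using tree_embed_arc[OF finV A f S F(2) kern D(2-4) _ _ y g] by blast
    next
      case 2
      \<comment> \<open>An arc pointing towards \<open>p\<close> is the previous case with all arcs
        reversed.\<close>
      have "\<exists>g. tree_embed (A\<inverse>) (F\<inverse>) (S\<inverse>) V f (insert y D) g"
        by (rule tree_embed_arc[OF finV A' f(1), where E = "E\<inverse>" and K = K and p = p and g = g])
          (use f S' F(2) kern D 2 y g in \<open>auto simp: tree_embed_converse\<close>)
      then show ?thesis by (simp add: tree_embed_converse)
    next
      case 3
      have gi: "inj_on g D" "g ` D \<subseteq> f ` V \<union> Field F"
        and ga: "\<And>u v. u \<in> D \<Longrightarrow> v \<in> D \<Longrightarrow> (u, v) \<in> A \<Longrightarrow> (g u, g v) \<in> F"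
        and gt: "\<And>x. x \<in> D \<Longrightarrow> g x = f x \<or> g x \<notin> f ` V \<and> (x \<in> Domain A \<longrightarrow> g x \<in> Domain S) \<and> (x \<in> Range A \<longrightarrow> g x \<in> Range S)"
        using g by (auto simp: tree_embed_def)
      have "f y \<notin> g ` D"
      proof
        assume "f y \<in> g ` D"
        then obtain x where x: "x \<in> D" "g x = f y" by auto
        then have "g x = f x" using gt[OF x(1)] D(3) by auto
        then show False using x D f(1) by (metis DiffD1 DiffD2 inj_onD subsetD)
      qed
      moreover have "inj_on (g(y := z)) (insert y D)" if "z \<notin> g ` D" for z
        using gi(1) D(3) that by (auto simp: inj_on_def)
      ultimately have inj: "inj_on (g(y := f y)) (insert y D)" by blast
      have none: "(y, y) \<notin> A" "\<And>x. x \<in> D \<Longrightarrow> (x, y) \<notin> A \<and> (y, x) \<notin> A"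
        using A 3 by (auto simp: oriented_def uadj_def)
      have "tree_embed A F S V f (insert y D) (g(y := f y))"
        unfolding tree_embed_def
      proof (intro conjI ballI impI inj)
        show "(g(y := f y)) ` insert y D \<subseteq> f ` V \<union> Field F" using gi(2) D(3) by auto
        show "((g(y := f y)) u, (g(y := f y)) v) \<in> F" if "u \<in> insert y D" "v \<in> insert y D" "(u, v) \<in> A" for u v
          using that ga none by auto
        show "(g(y := f y)) x = f x \<or> (g(y := f y)) x \<notin> f ` V \<and>
            (x \<in> Domain A \<longrightarrow> (g(y := f y)) x \<in> Domain S) \<and> (x \<in> Range A \<longrightarrow> (g(y := f y)) x \<in> Range S)"
          if "x \<in> insert y D" for x
          using that gt by auto
      qed
      then show ?thesis by blast
    qed
  qed (use finV AV acyc sep in \<open>auto simp: N_def\<close>)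
  then show ?thesis unfolding tree_embed_def using AV by blast
qed

subsection \<open>Dependent random choice\<close>

text \<open>Jensen's inequality for the \<open>r\<close>-th power, cleared of denominators.\<close>

lemma sum_power_le:
  fixes d :: "'i \<Rightarrow> nat"
  assumes "finite I" "r \<ge> 1"
  shows "(\<Sum>i\<in>I. d i) ^ r \<le> card I ^ (r - 1) * (\<Sum>i\<in>I. d i ^ r)"
proof (cases "I = {}")
  case False
  define c where "c = real (card I)"
  have c: "c > 0" using False assms by (simp add: c_def card_gt_0_iff)
  have conv: "convex_on {0::real..} (\<lambda>x. x ^ r)"
  proof (cases "even r")
    case True
    then show ?thesis using convex_power_even convex_on_subset by blast
  qed (rule convex_power_odd)
  have "(\<Sum>i\<in>I. (1 / c) *\<^sub>R real (d i)) ^ r \<le> (\<Sum>i\<in>I. (1 / c) * real (d i) ^ r)"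
    using c by (intro convex_on_sum[OF assms(1) False conv]) (auto simp: c_def)
  then have "((\<Sum>i\<in>I. real (d i)) / c) ^ r \<le> (\<Sum>i\<in>I. real (d i) ^ r) / c"
    by (simp add: sum_divide_distrib)
  then have "(\<Sum>i\<in>I. real (d i)) ^ r / c ^ r * c ^ r \<le> (\<Sum>i\<in>I. real (d i) ^ r) / c * c ^ r"
    using c by (intro mult_right_mono) (auto simp: power_divide)
  moreover have "c ^ r = c * c ^ (r - 1)" using assms(2) by (simp add: power_eq_if)
  ultimately have "(\<Sum>i\<in>I. real (d i)) ^ r \<le> c ^ (r - 1) * (\<Sum>i\<in>I. real (d i) ^ r)"
    using c by (simp add: mult.commute)
  then have "real ((\<Sum>i\<in>I. d i) ^ r) \<le> real (card I ^ (r - 1) * (\<Sum>i\<in>I. d i ^ r))"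
    by (simp add: c_def)
  then show ?thesis by (simp only: of_nat_le_iff)
qed (use assms in auto)

lemma sum_card_swap:
  assumes "finite S" "finite T"
  shows "(\<Sum>s\<in>S. card {t\<in>T. R s t}) = (\<Sum>t\<in>T. card {s\<in>S. R s t})"
proof -
  have "(\<Sum>s\<in>S. card {t\<in>T. R s t}) = (\<Sum>s\<in>S. \<Sum>t\<in>T. if R s t then 1 else 0)"
    using assms by (simp add: sum.If_cases Int_def)
  also have "\<dots> = (\<Sum>t\<in>T. \<Sum>s\<in>S. if R s t then 1 else 0)" by (rule sum.swap)
  also have "\<dots> = (\<Sum>t\<in>T. card {s\<in>S. R s t})"
    using assms by (simp add: sum.If_cases Int_def)
  finally show ?thesis .
qed

text \<open>Tuples in the random choice may repeat entries, so a set of at most \<open>r\<close>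
  vertices becomes an \<open>r\<close>-tuple by padding with \<open>w\<close>.\<close>

lemma tuple_onto:
  assumes "finite B" "card B \<le> r" "B \<subseteq> W" "W \<noteq> {}"
  obtains s where "s \<in> {..<r} \<rightarrow>\<^sub>E W" "B \<subseteq> s ` {..<r}"
proof -
  obtain w where w: "w \<in> W" using assms by blast
  obtain b where b: "bij_betw b {..<card B} B"
    using assms(1) by (metis atLeast0LessThan ex_bij_betw_nat_finite)
  define s where "s = (\<lambda>i\<in>{..<r}. if i < card B then b i else w)"
  have "s \<in> {..<r} \<rightarrow>\<^sub>E W"
    using bij_betwE[OF b] subsetD[OF assms(3)] w by (auto simp: s_def)
  moreover have "B \<subseteq> s ` {..<r}"
  proof
    fix x assume "x \<in> B"
    then obtain i where "i < card B" "x = b i" using b by (auto simp: bij_betw_def)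
    then show "x \<in> s ` {..<r}" using assms(2) by (intro image_eqI[of _ _ i]) (auto simp: s_def)
  qed
  ultimately show ?thesis using that by blast
qed

text \<open>Dependent random choice: for a random \<open>r\<close>-tuple \<open>t\<close>, the common neighbourhood of \<open>t\<close> is large
  on average but contains few \<open>r\<close>-tuples with fewer than \<open>h\<close> common neighbours.\<close>
lemma dependent_random_choice:
  fixes E :: "('b \<times> 'b) set"
  assumes U: "finite U" "card U = n" and E: "E \<subseteq> U \<times> U" and r: "r \<ge> 1" and n: "n \<ge> 1"
    and dense: "(h ^ r + h) * n ^ (2 * r - 1) \<le> card E ^ r"
  obtains W where "W \<subseteq> Range E" "h \<le> card W"
    "\<And>s. s \<in> {..<r} \<rightarrow>\<^sub>E W \<Longrightarrow> h \<le> card {u \<in> U. \<forall>i<r. (u, s i) \<in> E}"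
proof -
  define T where "T = {..<r} \<rightarrow>\<^sub>E U"
  \<comment> \<open>\<open>N s\<close> is a common in-neighbourhood, \<open>M t\<close> a common
    out-neighbourhood, and \<open>B t\<close> collects the bad tuples lying inside
    \<open>M t\<close>.\<close>
  define N where "N s = {u \<in> U. \<forall>i<r. (u, s i) \<in> E}" for s
  define M where "M t = {v \<in> U. \<forall>i<r. (t i, v) \<in> E}" for t
  define Bad where "Bad = {s \<in> T. card (N s) < h}"
  define B where "B t = {s \<in> Bad. \<forall>i<r. s i \<in> M t}" for t
  have finT: "finite T" unfolding T_def using U by (intro finite_PiE) auto
  have finBad: "finite Bad" using finT by (simp add: Bad_def)
  have cardT: "card T = n ^ r" unfolding T_def using U by (simp add: card_PiE)
  have sub: "{t \<in> T. \<forall>i<r. t i \<in> X} = {..<r} \<rightarrow>\<^sub>E X" if "X \<subseteq> U" for X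
    using that unfolding T_def PiE_def Pi_def by blast
  \<comment> \<open>There are \<open>n ^ r\<close> tuples, so this says that \<open>M t\<close> has
    average size at least \<open>h ^ r + h\<close>: count pairs by their vertex \<open>v\<close> to
    get a sum of \<open>r\<close>-th powers of in-degrees.\<close>
  have "n ^ r * (h ^ r + h) \<le> (\<Sum>t\<in>T. card (M t))"
  proof -
    have "(\<Sum>t\<in>T. card (M t)) = (\<Sum>v\<in>U. card {t \<in> T. \<forall>i<r. (t i, v) \<in> E})"
      unfolding M_def by (rule sum_card_swap[OF finT U(1)])
    also have "\<dots> = (\<Sum>v\<in>U. card (E\<inverse> `` {v}) ^ r)"
    proof (rule sum.cong[OF refl])
      fix v
      have "{t \<in> T. \<forall>i<r. (t i, v) \<in> E} = {..<r} \<rightarrow>\<^sub>E (E\<inverse> `` {v})"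
        using sub[of "E\<inverse> `` {v}"] E by auto
      then show "card {t \<in> T. \<forall>i<r. (t i, v) \<in> E} = card (E\<inverse> `` {v}) ^ r" by (simp add: card_PiE)
    qed
    finally have eq: "(\<Sum>t\<in>T. card (M t)) = (\<Sum>v\<in>U. card (E\<inverse> `` {v}) ^ r)" .
    have "card E = card (E\<inverse>)" by (simp add: card_inverse)
    also have "E\<inverse> = (SIGMA v:U. E\<inverse> `` {v})" using E by auto
    also have "card \<dots> = (\<Sum>v\<in>U. card (E\<inverse> `` {v}))"
      using U(1) E by (intro card_SigmaI) (auto intro!: finite_Image finite_subset[OF _ finite_cartesian_product[OF U(1) U(1)]])
    finally have "(h ^ r + h) * n ^ (2 * r - 1) \<le> n ^ (r - 1) * (\<Sum>t\<in>T. card (M t))"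
      using dense sum_power_le[OF U(1) r, of "\<lambda>v. card (E\<inverse> `` {v})"] U(2) eq by simp
    moreover have "n ^ (2 * r - 1) = n ^ (r - 1) * n ^ r" using r by (simp add: mult_2 flip: power_add)
    ultimately have "n ^ (r - 1) * (n ^ r * (h ^ r + h)) \<le> n ^ (r - 1) * (\<Sum>t\<in>T. card (M t))"
      by (simp add: mult_ac)
    then show ?thesis using n by simp
  qed
  \<comment> \<open>A bad \<open>s\<close> lies in \<open>M t\<close> only if all entries of
    \<open>t\<close> are in \<open>N s\<close>, which holds for at most \<open>h ^ r\<close> tuples
    \<open>t\<close>. So the average of \<open>card (B t)\<close> is at most
    \<open>h ^ r\<close>.\<close>
  moreover have "(\<Sum>t\<in>T. card (B t)) \<le> n ^ r * h ^ r"
  proof -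
    have "(\<Sum>t\<in>T. card (B t)) = (\<Sum>s\<in>Bad. card {t \<in> T. \<forall>i<r. s i \<in> M t})"
      unfolding B_def by (rule sum_card_swap[OF finT finBad])
    also have "\<dots> \<le> (\<Sum>s\<in>Bad. h ^ r)"
    proof (rule sum_mono)
      fix s assume s: "s \<in> Bad"
      have "{t \<in> T. \<forall>i<r. s i \<in> M t} \<subseteq> {..<r} \<rightarrow>\<^sub>E N s"
        unfolding T_def M_def N_def PiE_def Pi_def by blast
      then have "card {t \<in> T. \<forall>i<r. s i \<in> M t} \<le> card ({..<r} \<rightarrow>\<^sub>E N s)"
        using U by (intro card_mono finite_PiE) (auto simp: N_def)
      also have "\<dots> = card (N s) ^ r" by (simp add: card_PiE)
      also have "\<dots> \<le> h ^ r" using s by (intro power_mono) (auto simp: Bad_def)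
      finally show "card {t \<in> T. \<forall>i<r. s i \<in> M t} \<le> h ^ r" .
    qed
    also have "\<dots> \<le> n ^ r * h ^ r"
      using card_mono[OF finT, of Bad] cardT by (auto simp: Bad_def)
    finally show ?thesis .
  qed
  ultimately have avg: "n ^ r * h + (\<Sum>t\<in>T. card (B t)) \<le> (\<Sum>t\<in>T. card (M t))"
    by (simp add: distrib_left)
  have "\<exists>t\<in>T. h + card (B t) \<le> card (M t)"
  proof (rule ccontr)
    assume "\<not> ?thesis"
    then have "(\<Sum>t\<in>T. card (M t)) < (\<Sum>t\<in>T. h + card (B t))"
      using finT cardT n by (intro sum_strict_mono) (auto simp: not_le)
    also have "\<dots> = n ^ r * h + (\<Sum>t\<in>T. card (B t))" by (simp add: sum.distrib cardT)
    finally show False using avg by simp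
  qed
  then obtain t where t: "t \<in> T" "h + card (B t) \<le> card (M t)" by blast
  \<comment> \<open>Deleting the first entry of every bad tuple destroys all of them and costs at
    most \<open>card (B t)\<close> vertices.\<close>
  define W where "W = M t - (\<lambda>s. s 0) ` B t"
  have finB: "finite (B t)" using finBad by (simp add: B_def)
  show ?thesis
  proof
    have "M t \<subseteq> Range E" using r by (auto simp: M_def)
    then show "W \<subseteq> Range E" by (auto simp: W_def)
    have "card (M t) - card ((\<lambda>s. s 0) ` B t) \<le> card W"
      unfolding W_def using finB by (intro diff_card_le_card_Diff) auto
    moreover have "card ((\<lambda>s. s 0) ` B t) \<le> card (B t)" using finB by (rule card_image_le)
    ultimately show "h \<le> card W" using t(2) by linarith
    fix s assume s: "s \<in> {..<r} \<rightarrow>\<^sub>E W"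
    show "h \<le> card {u \<in> U. \<forall>i<r. (u, s i) \<in> E}"
    proof (rule ccontr)
      assume "\<not> ?thesis"
      moreover have "s \<in> T" using s by (auto simp: T_def PiE_iff W_def M_def)
      ultimately have "s \<in> Bad" by (simp add: Bad_def N_def)
      then have "s \<in> B t" using s by (auto simp: B_def PiE_iff W_def)
      then have "s 0 \<notin> W" by (auto simp: W_def)
      then show False using s r by (auto simp: PiE_iff)
    qed
  qed
qed

text \<open>Place \<open>Y\<close> anywhere in the set \<open>W\<close> from dependent random
  choice, then \<open>X\<close> greedily: the images of the at most \<open>r\<close> neighbours of
  \<open>x\<close> have at least \<open>h\<close> common in-neighbours, and fewer than
  \<open>h\<close> vertices are occupied.\<close>

lemma bipartite_embedding:
  fixes E :: "('b \<times> 'b) set" and A :: "('a \<times> 'a) set"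
  assumes U: "finite U" "card U = n" and E: "E \<subseteq> U \<times> U" and r: "r \<ge> 1" and n: "n \<ge> 1"
    and XY: "finite X" "finite Y" "X \<inter> Y = {}" "card X + card Y \<le> h" "h \<ge> 1"
    and A: "A \<subseteq> X \<times> Y" "\<And>x. x \<in> X \<Longrightarrow> card (A `` {x}) \<le> r"
    and dense: "(h ^ r + h) * n ^ (2 * r - 1) \<le> card E ^ r"
  shows "\<exists>g. inj_on g (X \<union> Y) \<and> g ` (X \<union> Y) \<subseteq> Field E \<and> (\<forall>(x, y) \<in> A. (g x, g y) \<in> E)"
proof -
  obtain W where W: "W \<subseteq> Range E" "h \<le> card W"
    and common: "\<And>s. s \<in> {..<r} \<rightarrow>\<^sub>E W \<Longrightarrow> h \<le> card {u \<in> U. \<forall>i<r. (u, s i) \<in> E}"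
    by (rule dependent_random_choice[OF U E r n dense]) (rule that)
  have finW: "finite W" and WU: "W \<subseteq> U" using W(1) E U(1) by (auto intro: finite_subset)
  have W0: "W \<noteq> {}" using W XY(5) by auto
  obtain g0 where g0: "inj_on g0 Y" "g0 ` Y \<subseteq> W"
    using card_le_inj[OF XY(2) finW] W(2) XY(4) by auto
  have "\<exists>g. inj_on g (X' \<union> Y) \<and> g ` (X' \<union> Y) \<subseteq> Field E \<and> g ` Y \<subseteq> W \<and> (\<forall>(x, y) \<in> A. x \<in> X' \<longrightarrow> (g x, g y) \<in> E)"
    if "X' \<subseteq> X" for X'
    using finite_subset[OF that XY(1)] that
  proof (induction X' rule: finite_induct)
    case empty
    show ?case using g0 W(1) by (intro exI[of _ g0]) (auto simp: Field_def)
  next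
    case (insert x X')
    then obtain g where g: "inj_on g (X' \<union> Y)" "g ` (X' \<union> Y) \<subseteq> Field E" "g ` Y \<subseteq> W"
      and "\<forall>(x, y)\<in>A. x \<in> X' \<longrightarrow> (g x, g y) \<in> E"
      by blast
    then have arcs: "(g x, g y) \<in> E" if "(x, y) \<in> A" "x \<in> X'" for x y using that by auto
    have xX: "x \<in> X" "x \<notin> X' \<union> Y" using insert XY(3) by auto
    have nb: "A `` {x} \<subseteq> Y" using A(1) by auto
    then have finA: "finite (A `` {x})" using XY(2) finite_subset by blast
    have "card (g ` (A `` {x})) \<le> r" using card_image_le[OF finA, of g] A(2)[OF xX(1)] by linarith
    moreover have "g ` (A `` {x}) \<subseteq> W" using nb g(3) by blast
    ultimately obtain s where s: "s \<in> {..<r} \<rightarrow>\<^sub>E W" "g ` (A `` {x}) \<subseteq> s ` {..<r}"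
      using tuple_onto[OF finite_imageI[OF finA], of g r W] W0 by auto
    define N where "N = {u \<in> U. \<forall>i<r. (u, s i) \<in> E}"
    have "card (g ` (X' \<union> Y)) < h"
    proof -
      have "card (g ` (X' \<union> Y)) \<le> card (X' \<union> Y)" using insert XY(2) by (intro card_image_le) auto
      also have "\<dots> \<le> card X' + card Y" by (rule card_Un_le)
      also have "card X' < card X" using insert XY(1) by (intro psubset_card_mono) auto
      finally show ?thesis using XY(4) by linarith
    qed
    then have "card (g ` (X' \<union> Y)) < card N" using common[OF s(1)] by (simp add: N_def)
    then have "\<not> N \<subseteq> g ` (X' \<union> Y)"
      using insert.hyps(1) XY(2) by (meson card_mono finite_UnI finite_imageI leD)
    then obtain u where u: "u \<in> N" "u \<notin> g ` (X' \<union> Y)" by blast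
    have uE: "(u, g y) \<in> E" if "(x, y) \<in> A" for y
      using s(2) that u(1) by (auto simp: N_def)
    have "u \<in> Field E" using u(1) r by (auto simp: N_def Field_def)
    show ?case
    proof (intro exI[of _ "g(x := u)"] conjI)
      show "inj_on (g(x := u)) (insert x X' \<union> Y)"
        using g(1) u(2) xX(2) by (auto simp: inj_on_def)
      show "(g(x := u)) ` (insert x X' \<union> Y) \<subseteq> Field E"
        using g(2) \<open>u \<in> Field E\<close> by auto
      show "(g(x := u)) ` Y \<subseteq> W" using g(3) xX(2) by auto
      show "\<forall>(z, y)\<in>A. z \<in> insert x X' \<longrightarrow> ((g(x := u)) z, (g(x := u)) y) \<in> E"
        using arcs uE A(1) xX(2) by auto
    qed
  qed
  then obtain g where g: "inj_on g (X \<union> Y)" "g ` (X \<union> Y) \<subseteq> Field E"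
    and "\<forall>(x, y) \<in> A. x \<in> X \<longrightarrow> (g x, g y) \<in> E"
    by blast
  then have "\<forall>(x, y) \<in> A. (g x, g y) \<in> E" using A(1) by auto
  with g show ?thesis by blast
qed

subsection \<open>The upper bounds\<close>

lemma sub_solvable1_deterministic:
  fixes St :: "'s set"
  assumes St: "finite St" "card St \<le> 2 ^ S" "ini \<in> St" "\<And>s e. s \<in> St \<Longrightarrow> upd s e \<in> St"
    and corr: "\<And>E xs. oriented {..<n} E \<Longrightarrow> distinct xs \<Longrightarrow> set xs = E \<Longrightarrow>
      sub_correct n V A E (res (foldl upd ini xs))"
  shows "sub_solvable1 V A n S"
proof -
  obtain enc :: "'s \<Rightarrow> nat" where enc: "inj_on enc St" "enc ` St \<subseteq> {..<2 ^ S}"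
    using card_le_inj[OF St(1), of "{..<2 ^ S :: nat}"] St(2) by auto
  \<comment> \<open>Numbers that encode no state are read as \<open>ini\<close>, so that the space
    bound holds for a step from any number below \<open>2 ^ S\<close>.\<close>
  define dec where "dec s = (if s \<in> enc ` St then inv_into St enc s else ini)" for s
  have dec_enc [simp]: "dec (enc s) = s" if "s \<in> St" for s using that enc(1) by (simp add: dec_def)
  have dec_St: "dec s \<in> St" for s using St(3) by (auto simp: dec_def inv_into_into)
  have lt: "enc s < 2 ^ S" if "s \<in> St" for s using that enc(2) by auto
  define step where "step s e = return_pmf (enc (upd (dec s) e))" for s e
  have run: "foldl (\<lambda>p a. bind_pmf p (\<lambda>s. step s a)) (return_pmf (enc s)) xs = return_pmf (enc (foldl upd s xs))"
    if "s \<in> St" for s xs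
    using that by (induction xs arbitrary: s) (simp_all add: step_def bind_return_pmf St(4))
  have fold_St: "foldl upd s xs \<in> St" if "s \<in> St" for s xs
    using that by (induction xs arbitrary: s) (simp_all add: St(4))
  show ?thesis
    unfolding sub_solvable1_def
  proof (intro exI conjI allI impI)
    show "space_bounded S (return_pmf (enc ini)) step"
      using lt St(3,4) dec_St by (auto simp: space_bounded_def step_def)
    fix E xs assume "oriented {..<n} E \<and> distinct xs \<and> set xs = E"
    then have "sub_correct n V A E (res (foldl upd ini xs))" using corr by blast
    moreover have "run1 (return_pmf (enc ini)) step (\<lambda>s. return_pmf (res (dec s))) xs
        = return_pmf (res (foldl upd ini xs))"
      unfolding run1_def run[OF St(3)] using fold_St[OF St(3)] by (simp add: bind_return_pmf)
    ultimately show "2 / 3 \<le> measure_pmf.prob (run1 (return_pmf (enc ini)) step (\<lambda>s. return_pmf (res (dec s))) xs) {r. sub_correct n V A E r}"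
      by (simp add: measure_return_pmf)
  qed
qed

section \<open>Contents and size of the memory\<close>

lemma card_bounded_subsets:
  assumes "finite U"
  shows "finite {F. F \<subseteq> U \<and> card F \<le> m}" "card {F. F \<subseteq> U \<and> card F \<le> m} \<le> (card U + 1) ^ m"
proof -
  \<comment> \<open>A set of at most \<open>m\<close> elements is listed and padded with
    \<open>None\<close> to length exactly \<open>m\<close>.\<close>
  define L where "L = {xs. set xs \<subseteq> insert None (Some ` U) \<and> length xs = m}"
  have fin: "finite L" unfolding L_def using assms by (intro finite_lists_length_eq) auto
  have sub: "{F. F \<subseteq> U \<and> card F \<le> m} \<subseteq> (\<lambda>xs. {x. Some x \<in> set xs}) ` L"
  proof safe
    fix F assume F: "F \<subseteq> U" "card F \<le> m"
    obtain xs where xs: "set xs = F" "distinct xs"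
      using finite_distinct_list[OF finite_subset[OF F(1) assms]] by blast
    then have "length xs \<le> m" using F(2) distinct_card by metis
    then have "map Some xs @ replicate (m - length xs) None \<in> L"
      using xs F(1) by (auto simp: L_def)
    moreover have "F = {x. Some x \<in> set (map Some xs @ replicate (m - length xs) None)}"
      using xs by auto
    ultimately show "F \<in> (\<lambda>xs. {x. Some x \<in> set xs}) ` L" by blast
  qed
  show "finite {F. F \<subseteq> U \<and> card F \<le> m}" using sub fin by (blast intro: finite_surj)
  have "card {F. F \<subseteq> U \<and> card F \<le> m} \<le> card L" using surj_card_le[OF fin sub] .
  also have "card L = (card U + 1) ^ m"
    unfolding L_def using assms by (subst card_lists_length_eq) (auto simp: card_image)
  finally show "card {F. F \<subseteq> U \<and> card F \<le> m} \<le> (card U + 1) ^ m" .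
qed

text \<open>The first component is a buffer for the first \<open>M\<close> arcs, the second the
  sparse kernel. Arcs with ends outside \<open>{..<n}\<close> are ignored because the space bound
  quantifies over all conceivable arcs.\<close>

definition kernel_step :: "nat \<Rightarrow> nat \<Rightarrow> nat \<Rightarrow> (nat \<times> nat) set \<times> (nat \<times> nat) set \<Rightarrow> nat \<times> nat \<Rightarrow> (nat \<times> nat) set \<times> (nat \<times> nat) set" where
  "kernel_step n M K s e = (if e \<in> {..<n} \<times> {..<n}
     then (if card (fst s) < M then insert e (fst s) else fst s,
           if cored K (snd s) e then snd s else insert e (snd s))
     else s)"

definition kernel_states :: "nat \<Rightarrow> nat \<Rightarrow> nat \<Rightarrow> ((nat \<times> nat) set \<times> (nat \<times> nat) set) set" where
  "kernel_states n M K = {F. F \<subseteq> {..<n} \<times> {..<n} \<and> card F \<le> M} \<times> {F. F \<subseteq> {..<n} \<times> {..<n} \<and> sparse K F}"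

lemma kernel_step_states:
  assumes "s \<in> kernel_states n M K" "K \<ge> 1"
  shows "kernel_step n M K s e \<in> kernel_states n M K"
proof -
  have "finite (snd s)" using assms(1) finite_subset[of _ "{..<n} \<times> {..<n}"] by (auto simp: kernel_states_def)
  moreover have "card (insert e (fst s)) \<le> M" if "card (fst s) < M"
    using that card_insert_le_m1[of "Suc (card (fst s))" "fst s" e] by simp
  ultimately show ?thesis
    using assms sparse_insert[of "snd s" K e] by (auto simp: kernel_states_def kernel_step_def)
qed

lemma kernel_states_card:
  shows "finite (kernel_states n M K)" "card (kernel_states n M K) \<le> (n * n + 1) ^ (M + 2 * K * n)"
proof -
  let ?U = "{..<n} \<times> {..<n}"
  let ?B = "\<lambda>m. {F. F \<subseteq> ?U \<and> card F \<le> m}"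
  have sp: "card F \<le> 2 * K * n" if "F \<subseteq> ?U" "sparse K F" for F
  proof -
    have "card F \<le> K * (card (Domain F) + card (Range F))"
      using that finite_subset[of F ?U] by (intro card_sparse_le) auto
    also have "\<dots> \<le> K * (card {..<n} + card {..<n})"
      using that(1) by (intro mult_le_mono2 add_mono card_mono) auto
    finally show ?thesis by (simp add: algebra_simps)
  qed
  have fin: "finite (?B m)" for m by (rule card_bounded_subsets) simp
  have "kernel_states n M K \<subseteq> ?B M \<times> ?B (2 * K * n)"
    using sp unfolding kernel_states_def by blast
  moreover have "finite (?B M \<times> ?B (2 * K * n))" using fin by blast
  ultimately show "finite (kernel_states n M K)" and "card (kernel_states n M K) \<le> (n * n + 1) ^ (M + 2 * K * n)"
  proof -
    assume *: "kernel_states n M K \<subseteq> ?B M \<times> ?B (2 * K * n)" "finite (?B M \<times> ?B (2 * K * n))"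
    show "finite (kernel_states n M K)" using * finite_subset by blast
    have "card (kernel_states n M K) \<le> card (?B M) * card (?B (2 * K * n))"
      using card_mono[OF *(2,1)] by (simp only: card_cartesian_product)
    also have "\<dots> \<le> (card ?U + 1) ^ M * (card ?U + 1) ^ (2 * K * n)"
      by (intro mult_le_mono card_bounded_subsets) auto
    finally show "card (kernel_states n M K) \<le> (n * n + 1) ^ (M + 2 * K * n)"
      by (simp add: power_add)
  qed
qed

text \<open>The kernel only grows and \<open>cored\<close> is monotone, so an arc that was cored
  when discarded is still cored at the end.\<close>

lemma kernel_invariant:
  assumes "set xs \<subseteq> {..<n} \<times> {..<n}" "distinct xs"
    and "s = foldl (kernel_step n M K) ({}, {}) xs"
  shows "fst s \<subseteq> set xs \<and> card (fst s) \<le> M \<and> (card (fst s) < M \<longrightarrow> fst s = set xs) \<and>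
    snd s \<subseteq> set xs \<and> (\<forall>e \<in> set xs - snd s. cored K (snd s) e)"
  using assms(1,2) unfolding assms(3)
proof (induction xs rule: rev_induct)
  case (snoc e xs)
  define s where "s = foldl (kernel_step n M K) ({}, {}) xs"
  have IH: "fst s \<subseteq> set xs" "card (fst s) \<le> M" "card (fst s) < M \<longrightarrow> fst s = set xs"
    "snd s \<subseteq> set xs" "\<forall>e \<in> set xs - snd s. cored K (snd s) e"
    using snoc by (auto simp: s_def)
  have e: "e \<in> {..<n} \<times> {..<n}" "e \<notin> set xs" using snoc.prems by auto
  have fin: "finite (fst s)" using IH(1) finite_subset by blast
  have "e \<notin> fst s" using e IH(1) by blast
  then have c: "card (insert e (fst s)) = Suc (card (fst s))" using fin by simp
  have "fst (kernel_step n M K s e) = (if card (fst s) < M then insert e (fst s) else fst s)"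
    and "snd (kernel_step n M K s e) = (if cored K (snd s) e then snd s else insert e (snd s))"
    using e by (auto simp: kernel_step_def)
  moreover have "cored K (insert e (snd s)) e'" if "cored K (snd s) e'" for e'
    using that by (rule cored_mono[rotated]) blast
  moreover have "set (xs @ [e]) = insert e (set xs)" by simp
  ultimately show ?case
    unfolding foldl_append foldl_Cons foldl_Nil s_def[symmetric]
    using IH c by (auto split: if_splits)
qed auto

text \<open>The algorithm outputs a copy found among the stored arcs, which is genuine since they
  belong to \<open>E\<close>; \<open>copy\<close> guarantees that none is missed. A buffer below its
  capacity contains all of \<open>E\<close>, hence the two alternatives for
  \<open>F0\<close>.\<close>

lemma R1_tildeO_by_kernel:
  assumes K: "K \<ge> 1" and e: "e \<ge> 1" and C: "C \<ge> 0" "\<And>n. real (M n) \<le> C * real n powr e + 1"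
    and copy: "\<And>n E F0 F1 f. n \<ge> 1 \<Longrightarrow> oriented {..<n} E \<Longrightarrow> F0 \<subseteq> E \<Longrightarrow> F0 = E \<or> card F0 = M n \<Longrightarrow> F1 \<subseteq> E \<Longrightarrow>
      (\<And>e. e \<in> E - F1 \<Longrightarrow> cored K F1 e) \<Longrightarrow> is_copy n V A E f \<Longrightarrow> \<exists>g. is_copy n V A (F0 \<union> F1) g"
  shows "R1_tildeO V A e"
proof -
  have "\<exists>S. sub_solvable1 V A n S \<and> real S \<le> (7 * (C + 1 + 2 * real K)) * real n powr e * ln (real n) ^ 1"
    if n: "n \<ge> 3" for n
  proof -
    \<comment> \<open>Bits for one stored slot, which holds one of \<open>n * n\<close> pairs or
      nothing. For \<open>n \<ge> 3\<close> this is at most \<open>6 * ln n + 1\<close>, hence the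
      constant 7.\<close>
    define l where "l = nat \<lceil>log 2 (real (n * n + 1))\<rceil>"
    define S where "S = l * (M n + 2 * K * n)"
    have q: "1 \<le> real (n * n + 1)" by (simp del: of_nat_add of_nat_mult)
    then have l0: "0 \<le> log 2 (real (n * n + 1))" by (subst zero_le_log_cancel_iff) linarith+
    have "real (n * n + 1) = 2 powr log 2 (real (n * n + 1))" by (rule powr_log_cancel[symmetric]) (use q in linarith)+
    also have "\<dots> \<le> 2 powr real l" unfolding l_def by (intro powr_mono real_nat_ceiling_ge) auto
    also have "\<dots> = real (2 ^ l)" by (simp add: powr_realpow)
    finally have "n * n + 1 \<le> 2 ^ l" by (simp only: of_nat_le_iff)
    then have "(n * n + 1) ^ (M n + 2 * K * n) \<le> (2 ^ l) ^ (M n + 2 * K * n)" by (rule power_mono) simp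
    then have "card (kernel_states n (M n) K) \<le> 2 ^ S"
      using kernel_states_card(2)[of n "M n" K] by (simp add: S_def power_mult)
    moreover define res where "res s = (if \<exists>g. is_copy n V A (fst s \<union> snd s) g
      then Some ((SOME g. is_copy n V A (fst s \<union> snd s) g) ` V) else None)" for s :: "(nat \<times> nat) set \<times> (nat \<times> nat) set"
    have "sub_correct n V A E (res (foldl (kernel_step n (M n) K) ({}, {}) xs))"
      if E: "oriented {..<n} E" "distinct xs" "set xs = E" for E xs
    proof -
      define s where "s = foldl (kernel_step n (M n) K) ({}, {}) xs"
      have "set xs \<subseteq> {..<n} \<times> {..<n}" using E by (auto simp: oriented_def)
      note inv = kernel_invariant[OF this E(2) s_def, unfolded E(3)]
      have sub: "fst s \<union> snd s \<subseteq> E" using inv by blast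
      show ?thesis
      proof (cases "\<exists>g. is_copy n V A (fst s \<union> snd s) g")
        case True
        then have "is_copy n V A (fst s \<union> snd s) (SOME g. is_copy n V A (fst s \<union> snd s) g)"
          by (rule someI_ex)
        then have "is_copy n V A E (SOME g. is_copy n V A (fst s \<union> snd s) g)"
          using sub unfolding is_copy_def by blast
        then show ?thesis using True unfolding s_def[symmetric] by (auto simp: sub_correct_def res_def)
      next
        case False
        have "fst s = E \<or> card (fst s) = M n" using inv by linarith
        then have "\<not> is_copy n V A E f" for f
          using copy[of n E "fst s" "snd s" f] inv False E(1) n by auto
        then show ?thesis using False unfolding s_def[symmetric] by (auto simp: sub_correct_def res_def)
      qed
    qed
    moreover have "({}, {}) \<in> kernel_states n (M n) K" by (auto simp: kernel_states_def sparse_def)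
    ultimately have "sub_solvable1 V A n S"
      using kernel_step_states[OF _ K] kernel_states_card(1)
      by (intro sub_solvable1_deterministic[where St = "kernel_states n (M n) K" and ini = "({}, {})"
            and upd = "kernel_step n (M n) K" and res = res]) auto
    moreover have "real S \<le> (7 * (C + 1 + 2 * real K)) * real n powr e * ln (real n) ^ 1"
    proof -
      have ln1: "ln (real n) \<ge> 1"
      proof -
        have "exp 1 \<le> real n" using exp_le n by linarith
        then show ?thesis using n by (simp add: ln_ge_iff)
      qed
      have ln2: "1 / 2 \<le> ln (2 :: real)"
      proof -
        have "1 \<le> ln (4 :: real)" using exp_le by (subst ln_ge_iff) auto
        also have "ln (4 :: real) = 2 * ln 2" using ln_realpow[of "2 :: real" 2] by simp
        finally show ?thesis by simp
      qed
      have "n * n + 1 \<le> n ^ 3"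
      proof -
        have "n * n + 1 \<le> 3 * (n * n)" using n by simp
        also have "\<dots> \<le> n * (n * n)" using n by (intro mult_right_mono) auto
        finally show ?thesis by (simp add: power3_eq_cube)
      qed
      then have "real (n * n + 1) \<le> real (n ^ 3)" by (simp only: of_nat_le_iff)
      then have "log 2 (real (n * n + 1)) \<le> log 2 (real (n ^ 3))"
        using q by (subst log_le_cancel_iff) linarith+
      also have "\<dots> = 3 * ln (real n) / ln 2" using n by (simp add: log_def ln_realpow)
      also have "\<dots> \<le> 3 * ln (real n) / (1/2)"
        using ln1 ln2 by (intro divide_left_mono) auto
      finally have "log 2 (real (n * n + 1)) \<le> 6 * ln (real n)" by simp
      moreover have "real l \<le> log 2 (real (n * n + 1)) + 1"
        unfolding l_def using l0 by linarith
      ultimately have l: "real l \<le> 7 * ln (real n)" using ln1 by linarith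
      have "real n powr 1 \<le> real n powr e" using n e by (intro powr_mono) auto
      then have ne: "real n \<le> real n powr e" "1 \<le> real n powr e" using n by auto
      have "real (M n + 2 * K * n) \<le> (C * real n powr e + 1) + 2 * real K * real n" using C(2)[of n] by simp
      also have "\<dots> \<le> (C * real n powr e + real n powr e) + 2 * real K * real n powr e"
        using ne C(1) by (intro add_mono mult_left_mono) auto
      also have "\<dots> = (C + 1 + 2 * real K) * real n powr e" by (simp add: distrib_right)
      finally have "real S \<le> (7 * ln (real n)) * ((C + 1 + 2 * real K) * real n powr e)"
        unfolding S_def of_nat_mult[of l] using l ln1 by (intro mult_mono) auto
      then show ?thesis by (simp add: mult_ac)
    qed
    ultimately show ?thesis by blast
  qed
  then show ?thesis unfolding R1_tildeO_def by blast
qed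

section \<open>Well-oriented components and the space bounds\<close>

lemma card_avoiding_le:
  assumes "finite U" "card U = n" "E \<subseteq> U \<times> U" "finite Z" "card Z \<le> h"
  shows "card E - 2 * h * n \<le> card {e \<in> E. fst e \<notin> Z \<and> snd e \<notin> Z}"
proof -
  let ?E' = "{e \<in> E. fst e \<notin> Z \<and> snd e \<notin> Z}"
  have "finite E" using assms finite_subset[of E "U \<times> U"] by simp
  have "E \<subseteq> ?E' \<union> (Z \<times> U \<union> U \<times> Z)" using assms(3) by auto
  then have "card E \<le> card (?E' \<union> (Z \<times> U \<union> U \<times> Z))"
    using assms \<open>finite E\<close> by (intro card_mono) auto
  also have "\<dots> \<le> card ?E' + card (Z \<times> U \<union> U \<times> Z)" by (rule card_Un_le)
  also have "card (Z \<times> U \<union> U \<times> Z) \<le> card (Z \<times> U) + card (U \<times> Z)" by (rule card_Un_le)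
  also have "\<dots> = 2 * card Z * n" using assms(2) by (simp add: card_cartesian_product)
  also have "\<dots> \<le> 2 * h * n" using assms(5) by simp
  finally show ?thesis by simp
qed

lemma card_Image_le_udeg:
  assumes "finite A"
  shows "card (A `` {x}) \<le> udeg A x" "card (A\<inverse> `` {x}) \<le> udeg A x"
proof -
  have "{u. uadj A u x} \<subseteq> Field A" by (auto simp: uadj_def Field_def)
  then have "finite {u. uadj A u x}" using finite_Field[OF assms] finite_subset by blast
  then show "card (A `` {x}) \<le> udeg A x" "card (A\<inverse> `` {x}) \<le> udeg A x"
    unfolding udeg_def by (auto intro!: card_mono simp: uadj_def)
qed

text \<open>On some components the vertices of \<open>X\<close> are the sources, on the others (\<open>W2\<close>) they are the sinks;
  the latter are embedded after reversing all arcs.\<close>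
lemma well_oriented_copy_in_dense:
  fixes A :: "('a \<times> 'a) set" and E :: "('b \<times> 'b) set"
  assumes V: "finite V" "A \<subseteq> V \<times> V" and wo: "\<And>v. \<not> non_wo A v"
    and X: "\<And>u v. (u, v) \<in> A \<Longrightarrow> u \<in> X \<longleftrightarrow> v \<notin> X" "\<And>x. x \<in> X \<Longrightarrow> udeg A x \<le> r"
    and U: "finite U" "card U = n" "E \<subseteq> U \<times> U" and r: "r \<ge> 1" and n: "n \<ge> 1"
    and Z: "finite Z" "card Z + card V \<le> h" "h \<ge> 1"
    and dense: "(h ^ r + h) * n ^ (2 * r - 1) \<le> (card E - 2 * h * n) ^ r"
  shows "\<exists>g. inj_on g V \<and> g ` V \<subseteq> U - Z \<and> (\<forall>(u, v) \<in> A. (g u, g v) \<in> E)"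
proof -
  \<comment> \<open>The vertices whose role agrees with \<open>X\<close> being the side of sources.
    An arc has both ends in \<open>W1\<close> or both outside; isolated vertices fall into
    \<open>W2\<close>.\<close>
  define W1 where "W1 = {v \<in> V. if v \<in> X then v \<in> Domain A else v \<in> Range A}"
  define W2 where "W2 = V - W1"
  have finA: "finite A" using V finite_subset by blast
  have DR: "x \<notin> Domain A \<or> x \<notin> Range A" for x using wo[of x] by (auto simp: non_wo_def)
  define A1 where "A1 = A \<inter> W1 \<times> W1"
  define A2 where "A2 = A \<inter> W2 \<times> W2"
  have split: "A = A1 \<union> A2"
  proof
    show "A \<subseteq> A1 \<union> A2"
    proof clarify
      fix u v assume uv: "(u, v) \<in> A" "(u, v) \<notin> A2"
      then have "u \<in> V" "v \<in> V" "u \<in> Domain A" "v \<in> Range A" "u \<notin> Range A" "v \<notin> Domain A"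
        using V(2) DR by blast+
      then show "(u, v) \<in> A1" using uv X(1)[OF uv(1)] by (auto simp: A1_def A2_def W1_def W2_def)
    qed
  qed (auto simp: A1_def A2_def)
  have A1: "A1 \<subseteq> (W1 \<inter> X) \<times> (W1 - X)"
  proof clarify
    fix u v assume uv: "(u, v) \<in> A1"
    then have A: "(u, v) \<in> A" "u \<in> W1" "v \<in> W1" by (auto simp: A1_def)
    then have "u \<notin> Range A" using DR by blast
    then have "u \<in> X" using A(2) unfolding W1_def by (auto split: if_splits)
    then show "u \<in> W1 \<inter> X \<and> v \<in> W1 - X" using A X(1)[OF A(1)] by auto
  qed
  have A2: "A2\<inverse> \<subseteq> (W2 \<inter> X) \<times> (W2 - X)"
  proof clarify
    fix u v assume uv: "(u, v) \<in> A2"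
    then have A: "(u, v) \<in> A" "u \<in> W2" "v \<in> W2" by (auto simp: A2_def)
    then have "u \<notin> X" using V(2) by (auto simp: W1_def W2_def)
    then show "v \<in> W2 \<inter> X \<and> u \<in> W2 - X" using A X(1)[OF A(1)] by auto
  qed
  have W: "finite W1" "finite W2" "W1 \<inter> W2 = {}" "W1 \<union> W2 = V"
    using V(1) by (auto simp: W1_def W2_def)
  then have cW: "card V = card W1 + card W2" using card_Un_disjoint[of W1 W2] by simp
  have cX: "card (W \<inter> X) + card (W - X) = card W" if "finite W" for W :: "'a set"
    using card_Un_disjoint[of "W \<inter> X" "W - X"] that by (simp add: Int_Diff_disjoint Int_Diff_Un)
  have d1: "card (A1 `` {x}) \<le> r" if "x \<in> X" for x
  proof -
    have "card (A1 `` {x}) \<le> card (A `` {x})"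
      using finA by (intro card_mono) (auto simp: A1_def intro: finite_Image)
    then show ?thesis using card_Image_le_udeg(1)[OF finA, of x] X(2)[OF that] by linarith
  qed
  have d2: "card (A2\<inverse> `` {x}) \<le> r" if "x \<in> X" for x
  proof -
    have "card (A2\<inverse> `` {x}) \<le> card (A\<inverse> `` {x})"
      using finA by (intro card_mono) (auto simp: A2_def intro: finite_Image)
    then show ?thesis using card_Image_le_udeg(2)[OF finA, of x] X(2)[OF that] by linarith
  qed
  \<comment> \<open>At most \<open>h\<close> avoided vertices touch at most \<open>2 * h * n\<close>
    arcs, which is the slack in the density assumption.\<close>
  have dense': "(h ^ r + h) * n ^ (2 * r - 1) \<le> card {e \<in> E. fst e \<notin> Z' \<and> snd e \<notin> Z'} ^ r"
    if "finite Z'" "card Z' \<le> h" for Z'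
    using dense power_mono[OF card_avoiding_le[OF U that], of r] by linarith
  define E1 where "E1 = {e \<in> E. fst e \<notin> Z \<and> snd e \<notin> Z}"
  have "\<exists>g. inj_on g ((W1 \<inter> X) \<union> (W1 - X)) \<and> g ` ((W1 \<inter> X) \<union> (W1 - X)) \<subseteq> Field E1 \<and> (\<forall>(x, y) \<in> A1. (g x, g y) \<in> E1)"
  proof (rule bipartite_embedding[OF U(1,2) _ r n])
    show "E1 \<subseteq> U \<times> U" using U(3) by (auto simp: E1_def)
    show "card (W1 \<inter> X) + card (W1 - X) \<le> h" using cX[OF W(1)] cW Z(2) by linarith
    show "(h ^ r + h) * n ^ (2 * r - 1) \<le> card E1 ^ r"
      unfolding E1_def using Z by (intro dense') auto
  qed (use W Z A1 d1 in auto)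
  then obtain g1 where g1: "inj_on g1 W1" "g1 ` W1 \<subseteq> Field E1" "\<forall>(x, y) \<in> A1. (g1 x, g1 y) \<in> E1"
    by (auto simp: Int_Diff_Un)
  \<comment> \<open>The second embedding must also avoid the image of the first; \<open>h\<close>
    leaves room for both.\<close>
  define Z2 where "Z2 = Z \<union> g1 ` W1"
  have Z2: "finite Z2" "card Z2 + card W2 \<le> h"
  proof -
    show "finite Z2" using Z W by (simp add: Z2_def)
    have "card Z2 \<le> card Z + card (g1 ` W1)" unfolding Z2_def by (rule card_Un_le)
    also have "card (g1 ` W1) \<le> card W1" using W by (intro card_image_le) auto
    finally show "card Z2 + card W2 \<le> h" using cW Z(2) by linarith
  qed
  define E2 where "E2 = {e \<in> E. fst e \<notin> Z2 \<and> snd e \<notin> Z2}"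
  have "\<exists>g. inj_on g ((W2 \<inter> X) \<union> (W2 - X)) \<and> g ` ((W2 \<inter> X) \<union> (W2 - X)) \<subseteq> Field (E2\<inverse>) \<and> (\<forall>(x, y) \<in> A2\<inverse>. (g x, g y) \<in> E2\<inverse>)"
  proof (rule bipartite_embedding[OF U(1,2) _ r n])
    show "E2\<inverse> \<subseteq> U \<times> U" using U(3) by (auto simp: E2_def)
    show "card (W2 \<inter> X) + card (W2 - X) \<le> h" using cX[OF W(2)] Z2 by linarith
    have "(h ^ r + h) * n ^ (2 * r - 1) \<le> card E2 ^ r"
      unfolding E2_def using Z2 by (intro dense') auto
    then show "(h ^ r + h) * n ^ (2 * r - 1) \<le> card (E2\<inverse>) ^ r" by (simp add: card_inverse)
  qed (use W Z A2 d2 in auto)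
  then obtain g2 where g2: "inj_on g2 W2" "g2 ` W2 \<subseteq> Field E2" "\<forall>(x, y) \<in> A2\<inverse>. (g2 x, g2 y) \<in> E2\<inverse>"
    by (auto simp: Int_Diff_Un Field_converse)
  have F: "Field E1 \<subseteq> U - Z" "Field E2 \<subseteq> U - Z2"
    using U(3) by (auto simp: E1_def E2_def Field_def)
  define g where "g v = (if v \<in> W1 then g1 v else g2 v)" for v
  have g_W: "g v = g1 v" if "v \<in> W1" for v using that by (simp add: g_def)
  have g_W2: "g v = g2 v" if "v \<in> W2" for v using that W(3) by (auto simp: g_def)
  have "inj_on g (W1 \<union> W2)"
    unfolding inj_on_Un
  proof (intro conjI)
    show "inj_on g W1" using g1(1) g_W by (simp cong: inj_on_cong)
    show "inj_on g W2" using g2(1) g_W2 by (simp cong: inj_on_cong)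
    have "g ` W1 = g1 ` W1" "g ` W2 = g2 ` W2" using g_W g_W2 by (auto intro!: image_cong)
    moreover have "g1 ` W1 \<inter> g2 ` W2 = {}" using g2(2) F(2) by (auto simp: Z2_def)
    ultimately show "g ` (W1 - W2) \<inter> g ` (W2 - W1) = {}" by blast
  qed
  moreover have "g ` V \<subseteq> U - Z"
  proof
    fix z assume "z \<in> g ` V"
    then obtain v where v: "v \<in> V" "z = g v" by blast
    show "z \<in> U - Z"
    proof (cases "v \<in> W1")
      case True
      then show ?thesis using v g_W g1(2) F(1) by auto
    next
      case False
      then have "v \<in> W2" using v by (simp add: W2_def)
      then have "z \<in> U - Z2" using v g_W2 g2(2) F(2) by auto
      then show ?thesis by (auto simp: Z2_def)
    qed
  qed
  moreover have "(g u, g v) \<in> E" if "(u, v) \<in> A" for u v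
  proof (cases "(u, v) \<in> A1")
    case True
    then have "(g1 u, g1 v) \<in> E1" "u \<in> W1" "v \<in> W1" using g1(3) by (auto simp: A1_def)
    then show ?thesis by (simp add: g_W E1_def)
  next
    case False
    then have "(u, v) \<in> A2" using that split by blast
    then have "(g2 u, g2 v) \<in> E2" "u \<in> W2" "v \<in> W2" using g2(3) by (auto simp: A2_def)
    then show ?thesis by (simp add: g_W2 E2_def)
  qed
  ultimately show ?thesis using W(4) by (intro exI[of _ g]) auto
qed

text \<open>The kernel alone suffices, so the buffer has capacity 0; \<open>K = 2 * card V\<close>
  is the degree that rerouting asks for.\<close>

lemma R1_tildeO_forest:
  assumes A: "oriented V A" "card V \<ge> 1" and acyc: "\<not> has_cycle_in A V"
    and sep: "\<And>u v. u \<in> V \<Longrightarrow> v \<in> V \<Longrightarrow> non_wo A u \<Longrightarrow> non_wo A v \<Longrightarrow> (uadj A)\<^sup>*\<^sup>* u v \<Longrightarrow> u = v"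
  shows "R1_tildeO V A 1"
proof (rule R1_tildeO_by_kernel[where K = "2 * card V" and C = 0 and M = "\<lambda>_. 0"])
  fix n E F0 F1 f
  assume E: "oriented {..<n} E" "F0 \<subseteq> E" "F1 \<subseteq> E" "\<And>e. e \<in> E - F1 \<Longrightarrow> cored (2 * card V) F1 e" "is_copy n V A E f"
  have En: "E \<subseteq> {..<n} \<times> {..<n}" using E(1) by (auto simp: oriented_def)
  have finF: "finite F1" by (rule finite_subset[OF order_trans[OF E(3) En]]) simp
  have f: "inj_on f V" "f ` V \<subseteq> {..<n}" "\<And>u v. (u, v) \<in> A \<Longrightarrow> (f u, f v) \<in> E"
    using E(5) by (auto simp: is_copy_def)
  obtain g where "inj_on g V" "g ` V \<subseteq> f ` V \<union> Field F1" "\<forall>(u, v) \<in> A. (g u, g v) \<in> F1"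
    using tree_copy_in_kernel[OF A(1) acyc sep f(1,3) finF order_refl E(4)] by blast
  moreover have "Field F1 \<subseteq> {..<n}" using E(3) En by (auto simp: Field_def)
  ultimately have "is_copy n V A (F0 \<union> F1) g" using f(2) unfolding is_copy_def by blast
  then show "\<exists>g. is_copy n V A (F0 \<union> F1) g" by blast
qed (use A in auto)

text \<open>The minimum in \<open>Delta'\<close> is attained on \<open>X\<close> or on its
  complement, and the complement is a bipartition class as well.\<close>

lemma udeg_le_Delta':
  assumes A: "oriented V A" and X: "bipartition V A X"
  obtains Y where "bipartition V A Y" "\<And>x. x \<in> Y \<Longrightarrow> udeg A x \<le> Delta' V A X"
proof -
  have finV: "finite V" and XV: "X \<subseteq> V" using A X by (auto simp: oriented_def bipartition_def)
  have mx: "udeg A x \<le> Max (insert 0 (udeg A ` Y))" if "x \<in> Y" "Y \<subseteq> V" for x Y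
    using that finite_subset[OF that(2) finV] by (intro Max_ge) auto
  show ?thesis
  proof (cases "Max (insert 0 (udeg A ` X)) \<le> Max (insert 0 (udeg A ` (V - X)))")
    case True
    then show ?thesis using that[of X] X mx[of _ X] XV by (simp add: Delta'_def)
  next
    case False
    have "bipartition V A (V - X)"
      using X A by (auto simp: bipartition_def oriented_def)
    then show ?thesis using that[of "V - X"] False mx[of _ "V - X"] by (simp add: Delta'_def)
  qed
qed

lemma Delta'_pos:
  assumes A: "oriented V A" and X: "bipartition V A X" and ne: "(u, v) \<in> A"
  shows "Delta' V A X \<ge> 1"
proof -
  have finV: "finite V" "A \<subseteq> V \<times> V" using A by (auto simp: oriented_def)
  have pos: "udeg A w \<ge> 1" if "uadj A z w" for z w
  proof -
    have "{u. uadj A u w} \<subseteq> V" using finV by (auto simp: uadj_def)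
    then have "finite {u. uadj A u w}" using finV finite_subset by blast
    then have "card {u. uadj A u w} > 0" using that by (auto simp: card_gt_0_iff)
    then show ?thesis by (simp add: udeg_def)
  qed
  have mx: "1 \<le> Max (insert 0 (udeg A ` Y))" if "x \<in> Y" "Y \<subseteq> V" "1 \<le> udeg A x" for x Y
  proof -
    have "udeg A x \<le> Max (insert 0 (udeg A ` Y))"
      using that finite_subset[OF that(2) finV(1)] by (intro Max_ge) auto
    then show ?thesis using that(3) by linarith
  qed
  have uv: "u \<in> V" "v \<in> V" "1 \<le> udeg A u" "1 \<le> udeg A v"
    using ne finV pos[of u v] pos[of v u] by (auto simp: uadj_def)
  have XV: "X \<subseteq> V" and "u \<in> X \<longleftrightarrow> v \<notin> X" using X ne by (auto simp: bipartition_def)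
  then have "u \<in> X \<and> v \<in> V - X \<or> v \<in> X \<and> u \<in> V - X" using uv by blast
  then show ?thesis unfolding Delta'_def using mx uv XV by (auto simp: min_def)
qed

text \<open>With a full buffer, the components with a non-well-oriented vertex are rerouted into the
  kernel first, wherever this leads. The rest is then placed afresh in the buffer, as dependent
  random choice can avoid any few given vertices.\<close>

lemma R1_tildeO_bipartite:
  assumes A: "oriented V A" and card: "card V \<ge> 1" and X: "bipartition V A X" and ne: "A \<noteq> {}"
    and sep: "\<And>u v. u \<in> V \<Longrightarrow> v \<in> V \<Longrightarrow> non_wo A u \<Longrightarrow> non_wo A v \<Longrightarrow> (uadj A)\<^sup>*\<^sup>* u v \<Longrightarrow> u = v"
    and acyc: "\<And>u. u \<in> V \<Longrightarrow> non_wo A u \<Longrightarrow> \<not> has_cycle_in A (component V A u)"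
  shows "R1_tildeO V A (2 - 1 / real (Delta' V A X))"
proof -
  define r where "r = Delta' V A X"
  define h where "h = card V"
  define ex where "ex = 2 - 1 / real r"
  \<comment> \<open>The summand \<open>2 * h\<close> pays for the arcs at avoided vertices and
    \<open>h ^ r + h\<close> for dependent random choice; \<open>ex\<close> is chosen so that
    \<open>ex * r = 2 * r - 1\<close>.\<close>
  define C where "C = real (2 * h + (h ^ r + h))"
  define M where "M n = nat \<lceil>C * real n powr ex\<rceil>" for n
  have r: "r \<ge> 1" unfolding r_def using Delta'_pos[OF A X] ne by auto
  obtain Y where Y: "bipartition V A Y" "\<And>x. x \<in> Y \<Longrightarrow> udeg A x \<le> r"
    using udeg_le_Delta'[OF A X] unfolding r_def by blast
  have h: "h \<ge> 1" using card by (simp add: h_def)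
  have finV: "finite V" and AV: "A \<subseteq> V \<times> V" using A by (auto simp: oriented_def)
  have ex: "ex \<ge> 1" using r by (simp add: ex_def divide_le_eq)
  have C0: "C \<ge> 0" by (simp add: C_def)
  have dense: "(h ^ r + h) * n ^ (2 * r - 1) \<le> (M n - 2 * h * n) ^ r" if n: "n \<ge> 1" for n
  proof -
    define c where "c = h ^ r + h"
    have "real n powr 1 \<le> real n powr ex" using n ex by (intro powr_mono) auto
    then have "2 * real h * real n \<le> 2 * real h * real n powr ex" using n by (intro mult_left_mono) auto
    then have "real c * real n powr ex + 2 * real h * real n \<le> C * real n powr ex"
      by (simp add: C_def c_def distrib_right)
    also have "\<dots> \<le> real (M n)" unfolding M_def by (rule real_nat_ceiling_ge)
    finally have M: "real c * real n powr ex \<le> real (M n) - real (2 * h * n)" by simp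
    also have "\<dots> \<le> real (M n - 2 * h * n)" by linarith
    finally have le: "real c * real n powr ex \<le> real (M n - 2 * h * n)" .
    \<comment> \<open>This permits using \<open>c\<close> itself in place of its \<open>r\<close>-th
      root in the buffer size.\<close>
    have "c \<le> c ^ r" using r h by (intro self_le_power) (auto simp: c_def)
    have "real (c * n ^ (2 * r - 1)) \<le> real c ^ r * real n ^ (2 * r - 1)"
      using \<open>c \<le> c ^ r\<close> by (simp add: mult_right_mono flip: of_nat_power)
    also have "real n ^ (2 * r - 1) = (real n powr ex) ^ r"
    proof -
      have "ex * real r = real (2 * r - 1)" using r by (simp add: ex_def left_diff_distrib of_nat_diff)
      then have "(real n powr ex) ^ r = real n powr real (2 * r - 1)"
        using n by (simp add: powr_powr flip: powr_realpow)
      then show ?thesis using n by (simp add: powr_realpow)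
    qed
    also have "real c ^ r * (real n powr ex) ^ r \<le> real (M n - 2 * h * n) ^ r"
      unfolding power_mult_distrib[symmetric] using le by (intro power_mono) auto
    finally have "real (c * n ^ (2 * r - 1)) \<le> real ((M n - 2 * h * n) ^ r)" by simp
    then show ?thesis unfolding c_def by (simp only: of_nat_le_iff)
  qed
  \<comment> \<open>The union of the components with a non-well-oriented vertex: the trees. What
    remains in \<open>VW\<close> is well-oriented.\<close>
  define VT where "VT = {v \<in> V. \<exists>u \<in> V. non_wo A u \<and> (uadj A)\<^sup>*\<^sup>* u v}"
  define VW where "VW = V - VT"
  define AT where "AT = A \<inter> VT \<times> VT"
  define AW where "AW = A \<inter> VW \<times> VW"
  have closed: "v \<in> VT" if "u \<in> VT" "uadj A u v" for u v
  proof -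
    have "v \<in> V" using that(2) AV by (auto simp: uadj_def)
    then show ?thesis using that by (auto simp: VT_def intro: rtranclp.rtrancl_into_rtrancl)
  qed
  have split: "A = AT \<union> AW"
  proof
    show "A \<subseteq> AT \<union> AW"
    proof clarify
      fix u v assume uv: "(u, v) \<in> A" "(u, v) \<notin> AW"
      then have "uadj A u v" "uadj A v u" "u \<in> V" "v \<in> V" using AV by (auto simp: uadj_def)
      then show "(u, v) \<in> AT" using closed uv by (auto simp: AT_def AW_def VW_def)
    qed
  qed (auto simp: AT_def AW_def)
  have ATA: "uadj AT u v \<Longrightarrow> uadj A u v" "non_wo AT v \<Longrightarrow> non_wo A v" for u v
    by (auto simp: uadj_def non_wo_def AT_def)
  have orT: "oriented VT AT" using A by (auto simp: oriented_def AT_def VT_def)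
  have sepT: "u = v" if "u \<in> VT" "v \<in> VT" "non_wo AT u" "non_wo AT v" "(uadj AT)\<^sup>*\<^sup>* u v" for u v
  proof -
    have "(uadj A)\<^sup>*\<^sup>* u v" using that(5) ATA(1) by (metis (mono_tags, lifting) mono_rtranclp)
    then show ?thesis using that ATA(2) by (intro sep) (auto simp: VT_def)
  qed
  have acycT: "\<not> has_cycle_in AT VT"
  proof
    assume "has_cycle_in AT VT"
    then obtain xs where xs: "length xs \<ge> 3" "distinct xs" "set xs \<subseteq> VT" "successively (uadj AT) (xs @ [hd xs])"
      unfolding has_cycle_in_iff by blast
    then have suc: "successively (uadj A) (xs @ [hd xs])"
      using ATA(1) by (auto elim: successively_mono)
    have "xs \<noteq> []" using xs(1) by auto
    then have "hd xs \<in> VT" using xs(3) by auto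
    then obtain u where u: "u \<in> V" "non_wo A u" "(uadj A)\<^sup>*\<^sup>* u (hd xs)" by (auto simp: VT_def)
    \<comment> \<open>A cycle through a vertex reachable from \<open>u\<close> stays in the
      component of \<open>u\<close>, so it contradicts \<open>acyc\<close>.\<close>
    have reach: "successively (uadj A) ys \<Longrightarrow> ys \<noteq> [] \<Longrightarrow> (uadj A)\<^sup>*\<^sup>* u (hd ys) \<Longrightarrow> \<forall>y \<in> set ys. (uadj A)\<^sup>*\<^sup>* u y" for ys
    proof (induction ys)
      case (Cons y ys)
      show ?case
      proof (cases "ys = []")
        case False
        then have "(uadj A)\<^sup>*\<^sup>* u (hd ys)"
          using Cons.prems by (auto simp: successively_Cons intro: rtranclp.rtrancl_into_rtrancl)
        then show ?thesis using Cons False by (auto simp: successively_Cons)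
      qed (use Cons in auto)
    qed simp
    have "\<forall>y \<in> set xs. (uadj A)\<^sup>*\<^sup>* u y"
      using suc \<open>xs \<noteq> []\<close> u(3) by (intro reach) (auto simp: successively_append_iff)
    then have "set xs \<subseteq> component V A u" using xs(3) by (auto simp: component_def VT_def)
    then have "has_cycle_in A (component V A u)" unfolding has_cycle_in_iff using xs suc by blast
    then show False using acyc u by blast
  qed
  have woW: "\<not> non_wo AW v" for v
  proof
    assume v: "non_wo AW v"
    then have "v \<in> VW" "non_wo A v" by (auto simp: non_wo_def AW_def)
    then show False by (auto simp: VW_def VT_def)
  qed
  have finT: "finite VT" and cT: "card VT + card VW = card V"
    using finV card_Un_disjoint[of VT VW] finite_subset[of VT V] by (auto simp: VW_def VT_def Un_absorb1 Collect_mono_iff)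
  have "R1_tildeO V A ex"
  proof (rule R1_tildeO_by_kernel[where K = "2 * card V" and C = C and M = M])
    show "real (M n) \<le> C * real n powr ex + 1" for n
    proof -
      have "0 \<le> C * real n powr ex" using C0 by simp
      then show ?thesis unfolding M_def by linarith
    qed
    fix n E F0 F1 f
    assume E: "n \<ge> 1" "oriented {..<n} E" "F0 \<subseteq> E" "F0 = E \<or> card F0 = M n" "F1 \<subseteq> E"
      "\<And>e. e \<in> E - F1 \<Longrightarrow> cored (2 * card V) F1 e" "is_copy n V A E f"
    show "\<exists>g. is_copy n V A (F0 \<union> F1) g"
      using E(4)
    proof
      assume "F0 = E"
      then have "F0 \<union> F1 = E" using E(5) by blast
      then show ?thesis using E(7) by auto
    next
      assume cF: "card F0 = M n"
      have En: "E \<subseteq> {..<n} \<times> {..<n}" using E(2) by (auto simp: oriented_def)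
      have finF: "finite F1" by (rule finite_subset[OF order_trans[OF E(5) En]]) simp
      have f: "inj_on f VT" "f ` VT \<subseteq> {..<n}" "\<And>u v. (u, v) \<in> AT \<Longrightarrow> (f u, f v) \<in> E"
        using E(7) by (auto simp: is_copy_def VT_def AT_def inj_on_def)
      have "2 * card VT \<le> 2 * card V" using cT by simp
      from tree_copy_in_kernel[OF orT acycT sepT f(1,3) finF this E(6)]
      obtain g1 where g1: "inj_on g1 VT" "g1 ` VT \<subseteq> f ` VT \<union> Field F1" "\<forall>(u, v) \<in> AT. (g1 u, g1 v) \<in> F1"
        by blast
      have g1n: "g1 ` VT \<subseteq> {..<n}" using g1(2) f(2) E(5) En by (fastforce simp: Field_def)
      have "\<exists>g. inj_on g VW \<and> g ` VW \<subseteq> {..<n} - g1 ` VT \<and> (\<forall>(u, v) \<in> AW. (g u, g v) \<in> F0)"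
      proof (rule well_oriented_copy_in_dense[where X = Y and r = r and n = n and h = h])
        show "udeg AW x \<le> r" if "x \<in> Y" for x
        proof -
          have "{u. uadj A u x} \<subseteq> V" using AV by (auto simp: uadj_def)
          then have "finite {u. uadj A u x}" by (rule finite_subset[OF _ finV])
          then have "udeg AW x \<le> udeg A x"
            unfolding udeg_def by (intro card_mono) (auto simp: uadj_def AW_def)
          then show ?thesis using Y(2)[OF that] by linarith
        qed
        show "u \<in> Y \<longleftrightarrow> v \<notin> Y" if "(u, v) \<in> AW" for u v
          using that Y(1) by (auto simp: AW_def bipartition_def)
        have "card (g1 ` VT) \<le> card VT" by (rule card_image_le[OF finT])
        then show "card (g1 ` VT) + card VW \<le> h" using cT by (simp add: h_def)
        show "(h ^ r + h) * n ^ (2 * r - 1) \<le> (card F0 - 2 * h * n) ^ r"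
          unfolding cF by (rule dense[OF E(1)])
        show "F0 \<subseteq> {..<n} \<times> {..<n}" using E(3) En by blast
      qed (use finV finT woW r h E(1) in \<open>auto simp: VW_def AW_def\<close>)
      then obtain g2 where g2: "inj_on g2 VW" "g2 ` VW \<subseteq> {..<n} - g1 ` VT" "\<forall>(u, v) \<in> AW. (g2 u, g2 v) \<in> F0"
        by blast
      define g where "g v = (if v \<in> VT then g1 v else g2 v)" for v
      have gT: "g v = g1 v" if "v \<in> VT" for v using that by (simp add: g_def)
      have gW: "g v = g2 v" if "v \<in> VW" for v using that by (simp add: g_def VW_def)
      have V_eq: "V = VT \<union> VW" by (auto simp: VW_def VT_def)
      have img: "g ` VT = g1 ` VT" "g ` VW = g2 ` VW" using gT gW by (auto intro!: image_cong)
      have "inj_on g (VT \<union> VW)"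
        unfolding inj_on_Un
      proof (intro conjI)
        show "inj_on g VT" using g1(1) gT by (simp cong: inj_on_cong)
        show "inj_on g VW" using g2(1) gW by (simp cong: inj_on_cong)
        show "g ` (VT - VW) \<inter> g ` (VW - VT) = {}" using g2(2) img by blast
      qed
      moreover have "g ` V \<subseteq> {..<n}" unfolding V_eq image_Un img using g1n g2(2) by blast
      moreover have "(g u, g v) \<in> F0 \<union> F1" if "(u, v) \<in> A" for u v
      proof (cases "(u, v) \<in> AT")
        case True
        then have "(g1 u, g1 v) \<in> F1" "u \<in> VT" "v \<in> VT" using g1(3) by (auto simp: AT_def)
        then show ?thesis by (simp add: gT)
      next
        case False
        then have "(u, v) \<in> AW" using that split by blast
        then have "(g2 u, g2 v) \<in> F0" "u \<in> VW" "v \<in> VW" using g2(3) by (auto simp: AW_def)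
        then show ?thesis by (simp add: gW)
      qed
      ultimately have "is_copy n V A (F0 \<union> F1) g" unfolding is_copy_def using V_eq by auto
      then show ?thesis by blast
    qed
  qed (use card ex C0 in auto)
  then show ?thesis by (simp add: ex_def r_def)
qed

section \<open>Assembling the three cases\<close>

theorem theorem7:
  fixes V :: "'a set" and A :: "('a \<times> 'a) set"
  assumes "oriented V A" and "card V \<ge> 3" and "bipartite V A" and "\<not> well_oriented V A"
  shows "((\<exists>C \<in> components V A. (\<exists>u \<in> C. \<exists>v \<in> C. u \<noteq> v \<and> non_wo A u \<and> non_wo A v)
              \<or> ((\<exists>u \<in> C. non_wo A u) \<and> has_cycle_in A C))
           \<longrightarrow> R1_Omega_n2 V A)
       \<and> ((\<not> (\<exists>C \<in> components V A. (\<exists>u \<in> C. \<exists>v \<in> C. u \<noteq> v \<and> non_wo A u \<and> non_wo A v)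
              \<or> ((\<exists>u \<in> C. non_wo A u) \<and> has_cycle_in A C)) \<and> forest V A)
           \<longrightarrow> R1_tildeO V A 1)
       \<and> ((\<not> (\<exists>C \<in> components V A. (\<exists>u \<in> C. \<exists>v \<in> C. u \<noteq> v \<and> non_wo A u \<and> non_wo A v)
              \<or> ((\<exists>u \<in> C. non_wo A u) \<and> has_cycle_in A C)) \<and> \<not> forest V A)
           \<longrightarrow> (\<forall>C \<in> components V A. well_oriented C (A \<inter> C \<times> C)
                   \<or> (\<not> has_cycle_in A C \<and> card {v \<in> C. non_wo A v} = 1))
             \<and> (\<forall>X. bipartition V A X \<longrightarrow> R1_tildeO V A (2 - 1 / real (Delta' V A X))))"
    (is "(?hard \<longrightarrow> _) \<and> (\<not> ?hard \<and> _ \<longrightarrow> _) \<and> (\<not> ?hard \<and> _ \<longrightarrow> ?comps \<and> ?upper)")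
proof -
  note A = assms(1)
  have AV: "A \<subseteq> V \<times> V" using A by (auto simp: oriented_def)
  have hard: "R1_Omega_n2 V A" if ?hard
  proof -
    from that obtain C where C: "C \<in> components V A"
      "(\<exists>u \<in> C. \<exists>v \<in> C. u \<noteq> v \<and> non_wo A u \<and> non_wo A v) \<or> (\<exists>u \<in> C. non_wo A u) \<and> has_cycle_in A C"
      by blast
    note conn = component_connected[OF C(1)]
    from C(2) have "\<exists>L. odd_walks A L \<noteq> {}"
    proof
      assume "\<exists>u \<in> C. \<exists>v \<in> C. u \<noteq> v \<and> non_wo A u \<and> non_wo A v"
      then obtain u v where "u \<in> C" "v \<in> C" "u \<noteq> v" "non_wo A u" "non_wo A v" by blast
      then show ?thesis using odd_walk_between_non_wo[OF conn] by simp
    next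
      assume "(\<exists>u \<in> C. non_wo A u) \<and> has_cycle_in A C"
      then obtain u where u: "u \<in> C" "non_wo A u" "has_cycle_in A C" by blast
      show ?thesis by (rule odd_walk_to_cycle[OF u(2,3) conn[OF u(1)]])
    qed
    then show ?thesis using R1_Omega_n2_if_odd_walk[OF A] by blast
  qed
  have self: "u \<in> component V A u" "component V A u \<in> components V A" if "u \<in> V" for u
    using that by (auto simp: component_def components_def)
  have sep: "u = v" if "\<not> ?hard" "u \<in> V" "v \<in> V" "non_wo A u" "non_wo A v" "(uadj A)\<^sup>*\<^sup>* u v" for u v
  proof -
    have "v \<in> component V A u" using that by (simp add: component_def)
    then show ?thesis using that self[of u] by blast
  qed
  have acyc: "\<not> has_cycle_in A (component V A u)" if "\<not> ?hard" "u \<in> V" "non_wo A u" for u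
    using that self[of u] by blast
  have forest: "R1_tildeO V A 1" if "\<not> ?hard" "forest V A"
  proof (rule R1_tildeO_forest[OF A])
    show "1 \<le> card V" using assms(2) by linarith
    show "\<not> has_cycle_in A V" using that(2) by (simp add: forest_def)
  qed (rule sep[OF that(1)])
  have comps: ?comps if "\<not> ?hard"
  proof
    fix C assume C: "C \<in> components V A"
    show "well_oriented C (A \<inter> C \<times> C) \<or> \<not> has_cycle_in A C \<and> card {v \<in> C. non_wo A v} = 1"
    proof (cases "\<exists>v \<in> C. non_wo A v")
      case True
      then obtain v where v: "v \<in> C" "non_wo A v" by blast
      then have "{v \<in> C. non_wo A v} = {v}" using that C by blast
      then show ?thesis using that C v by auto
    next
      case False
      \<comment> \<open>Without non-well-oriented vertices the tails of arcs form one side.\<close>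
      then have "well_oriented C (A \<inter> C \<times> C)"
        unfolding well_oriented_def by (intro exI[of _ "C \<inter> Domain A"]) (auto simp: non_wo_def)
      then show ?thesis by blast
    qed
  qed
  have upper: ?upper if "\<not> ?hard"
  proof (intro allI impI)
    fix X assume X: "bipartition V A X"
    \<comment> \<open>An arcless graph would be well-oriented; having an arc makes
      \<open>Delta'\<close> positive.\<close>
    have "A \<noteq> {}" using assms(4) by (auto simp: well_oriented_def)
    have "1 \<le> card V" using assms(2) by linarith
    from R1_tildeO_bipartite[OF A this X \<open>A \<noteq> {}\<close> sep[OF that] acyc[OF that]]
    show "R1_tildeO V A (2 - 1 / real (Delta' V A X))" .
  qed
  show ?thesis using hard forest comps upper by blast
qed

end
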